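(* Let $g\in\{1,\ldots,2^{n_-}\}$ and let $h\in\mathbb{E}$ with $h\subseteq[n]^+$. Then $([n],h,[n])\in\mathbb{P}$ (so $C_h$ is defined), and the center $\mathrm{Z}(\mathbb{T}D_g)$ of the block algebra $\mathbb{T}D_g$ of $\mathbb{T}$ has an $\mathbb{F}$-basis $\{C_aD_g: a\in\mathbb{E},\ a\subseteq[n]^+\}$. In particular, the $\mathbb{F}$-dimension of $\mathrm{Z}(\mathbb{T}D_g)$ is $2^{n_+}$. Moreover, $\mathrm{Rad}(\mathrm{Z}(\mathbb{T}D_g))$ has an $\mathbb{F}$-basis $\{C_aD_g: a\in\mathbb{E}\setminus\{\varnothing\},\ a\subseteq[n]^+\}$, and the nilpotent index of $\mathrm{Rad}(\mathrm{Z}(\mathbb{T}D_g))$ is $n_++1$. In particular, the $\mathbb{F}$-dimension of $\mathrm{Rad}(\mathrm{Z}(\mathbb{T}D_g))$ is $2^{n_+}-1$.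
   Context: Setting. Let $\mathbb{F}$ be a field of characteristic $p$ (possibly $p=0$; $0\mid m$ iff $m=0$). For an integer $m$, $\overline{m}$ is its image in $\mathbb{F}$. Let $n\ge 1$, let $\mathbb{U}_1,\ldots,\mathbb{U}_n$ be finite sets with $|\mathbb{U}_a|\ge 2$, let $\mathbb{X}=\prod_{a=1}^n\mathbb{U}_a$, and fix $\mathbf{x}\in\mathbb{X}$. Let $\mathbb{E}$ be the set of all subsets of $[n]=\{1,\ldots,n\}$ (the paper uses tuples in $\{0,1\}^n$; here a tuple is identified with its support). For $h\in\mathbb{E}$ let $R_h=\{(y,z)\in\mathbb{X}\times\mathbb{X}: y_a\neq z_a \text{ iff } a\in h\}$; $(\mathbb{X},\{R_h\}_{h\in\mathbb{E}})$ is the factorial association scheme. In the full matrix algebra $\mathrm{M}_\mathbb{X}(\mathbb{F})$, $A_h$ is the adjacency matrix of $R_h$, and $E_h^*$ is the diagonal matrix whose $(y,y)$-entry is $1$ if $(\mathbf{x},y)\in R_h$ and $0$ otherwise. The Terwilliger $\mathbb{F}$-algebra $\mathbb{T}$ is the $\mathbb{F}$-subalgebra of $\mathrm{M}_\mathbb{X}(\mathbb{F})$ generated by all $A_h$ and $E_h^*$, $h\in\mathbb{E}$. Notation. $k_h=\prod_{a\in h}(|\mathbb{U}_a|-1)$ (with $k_\varnothing=1$). For $V\subseteq[n]$: $V^\circ=\{a\in V: |\mathbb{U}_a|\neq 2\}$, $V^+=\{a\in V: p\mid |\mathbb{U}_a|-1\}$, $V^-=\{a\in V: |\mathbb{U}_a|\ne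 2,\ p\nmid|\mathbb{U}_a|-1\}$; $n_\pm=|[n]^\pm|$. $\triangle$ is symmetric difference. $\mathbb{P}=\{(a,b,c)\in\mathbb{E}^3: a\triangle c\subseteq b\subseteq (a\triangle c)\cup(a\cap c)^\circ\}$, and for $(a,b,c)\in\mathbb{P}$, $B_{a,b,c}=\sum_{a\triangle c\subseteq j\subseteq b}E_a^*A_jE_c^*$. For $a\in\mathbb{E}$ with $([n],a,[n])\in\mathbb{P}$, $C_a=\sum_{j\in\mathbb{E}}\overline{k_{a\setminus j}}\,B_{j,a\cap j,j}$. For $(a,b,c)\in\mathbb{P}$ with $p\nmid k_b$, $$D_{a,b,c}=\sum_{q}(\overline{-1})^{|q\setminus b|}\,\overline{k_{c\cap q}}^{\,-1}B_{a,q,c},$$ the sum over all $q\in\mathbb{E}$ with $b\subseteq q\subseteq (a\triangle c)\cup(a\cap c)^\circ$ and $p\nmid k_q$. On $\{(a,b,a)\in\mathbb{P}: p\nmid k_b\}$ put $(a,b,a)\approx(a',b',a')$ iff $a^-\setminus b=a'^-\setminus b'$. This is an equivalence relation with exactly $2^{n_-}$ classes; enumerate them as $\mathbb{C}_1,\ldots,\mathbb{C}_{2^{n_-}}$. For $m\in\{1,\ldots,2^{n_-}\}$ let $D_m=\sum_{(a,b,a)\in\mathbb{C}_m}D_{a,b,a}$. The matrices $D_1,\ldots,D_{2^{n_-}}$ are the primitive idempotents of the center of $\mathbb{T}$ (block idempotents), and $\mathbb{T}D_g$ is called a block algebra of $\mathbb{T}$; it is an algebra with identity $D_g$. $\mathrm{Rad}$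 denotes the Jacobson radical; the nilpotent index of a nilpotent two-sided ideal $\mathbb{I}$ is the smallest $t\ge1$ such that the product of any $t$ elements of $\mathbb{I}$ is zero. *)

theory Defs
  imports
    "HOL-Library.FuncSet"
    "HOL-Library.Function_Algebras"
    "HOL-Computational_Algebra.Computational_Algebra"
begin

section \<open>Matrices indexed by a finite set\<close>

text \<open>
  A matrix with rows and columns indexed by a set \<open>X\<close> is a function of two arguments that
  vanishes outside \<open>X \<times> X\<close>. Addition, zero and finite sums are the pointwise ones of
  \<open>HOL-Library.Function_Algebras\<close>; the pointwise product of that theory is never used.
\<close>

type_synonym ('i, 'f) mat = "'i \<Rightarrow> 'i \<Rightarrow> 'f"

definition mats :: "'i set \<Rightarrow> ('i, 'f::field) mat set" where
  "mats X = {A. \<forall>y z. (y, z) \<notin> X \<times> X \<longrightarrow> A y z = 0}"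

definition msmult :: "'f::field \<Rightarrow> ('i, 'f) mat \<Rightarrow> ('i, 'f) mat" where
  "msmult c A = (\<lambda>y z. c * A y z)"

definition mmul :: "'i set \<Rightarrow> ('i, 'f::field) mat \<Rightarrow> ('i, 'f) mat \<Rightarrow> ('i, 'f) mat" where
  "mmul X A B = (\<lambda>y z. \<Sum>w\<in>X. A y w * B w z)"

definition mone :: "'i set \<Rightarrow> ('i, 'f::field) mat" where
  "mone X = (\<lambda>y z. of_bool (y = z \<and> y \<in> X))"

interpretation mat: vector_space "msmult :: 'f::field \<Rightarrow> ('i, 'f) mat \<Rightarrow> ('i, 'f) mat"
  by unfold_locales (simp_all add: msmult_def fun_eq_iff algebra_simps)

definition is_basis :: "('i, 'f::field) mat set \<Rightarrow> ('i, 'f) mat set \<Rightarrow> bool" where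
  "is_basis S V \<longleftrightarrow> mat.independent S \<and> mat.span S = V"


section \<open>Algebras of matrices\<close>

definition is_subalgebra :: "'i set \<Rightarrow> ('i, 'f::field) mat set \<Rightarrow> bool" where
  "is_subalgebra X S \<longleftrightarrow>
     S \<subseteq> mats X \<and> mat.subspace S \<and> mone X \<in> S \<and> (\<forall>A\<in>S. \<forall>B\<in>S. mmul X A B \<in> S)"

definition alg_center :: "'i set \<Rightarrow> ('i, 'f::field) mat set \<Rightarrow> ('i, 'f) mat set" where
  "alg_center X B = {z \<in> B. \<forall>b\<in>B. mmul X z b = mmul X b z}"

text \<open>
  In the next three definitions \<open>B\<close> is a matrix algebra that has an identity, which need not
  be \<open>mone X\<close>. Because of that identity, a left ideal in the ring sense is automatically a
  linear subspace.
\<close>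

definition left_ideal :: "'i set \<Rightarrow> ('i, 'f::field) mat set \<Rightarrow> ('i, 'f) mat set \<Rightarrow> bool" where
  "left_ideal X B I \<longleftrightarrow> I \<subseteq> B \<and> mat.subspace I \<and> (\<forall>b\<in>B. \<forall>i\<in>I. mmul X b i \<in> I)"

definition maximal_left_ideal ::
    "'i set \<Rightarrow> ('i, 'f::field) mat set \<Rightarrow> ('i, 'f) mat set \<Rightarrow> bool" where
  "maximal_left_ideal X B I \<longleftrightarrow>
     left_ideal X B I \<and> I \<noteq> B \<and> (\<forall>J. left_ideal X B J \<and> I \<subseteq> J \<longrightarrow> J = I \<or> J = B)"

definition jacobson_radical :: "'i set \<Rightarrow> ('i, 'f::field) mat set \<Rightarrow> ('i, 'f) mat set" where
  "jacobson_radical X B = {z \<in> B. \<forall>I. maximal_left_ideal X B I \<longrightarrow> z \<in> I}"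

definition products_vanish :: "'i set \<Rightarrow> ('i, 'f::field) mat set \<Rightarrow> nat \<Rightarrow> bool" where
  "products_vanish X I t \<longleftrightarrow>
     (\<forall>As. length As = t \<and> set As \<subseteq> I \<longrightarrow> foldr (mmul X) As (mone X) = 0)"

text \<open>A predicate rather than a function, so that it asserts nilpotency as well.\<close>

definition has_nilpotent_index :: "'i set \<Rightarrow> ('i, 'f::field) mat set \<Rightarrow> nat \<Rightarrow> bool" where
  "has_nilpotent_index X I t \<longleftrightarrow>
     1 \<le> t \<and> products_vanish X I t \<and> (\<forall>s. 1 \<le> s \<and> s < t \<longrightarrow> \<not> products_vanish X I s)"


section \<open>The factorial scheme and its Terwilliger algebra\<close>

definition points :: "nat \<Rightarrow> (nat \<Rightarrow> 'u set) \<Rightarrow> (nat \<Rightarrow> 'u) set" where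
  "points n U = (\<Pi>\<^sub>E a\<in>{1..n}. U a)"

definition srel :: "nat \<Rightarrow> (nat \<Rightarrow> 'u set) \<Rightarrow> nat set \<Rightarrow> ((nat \<Rightarrow> 'u) \<times> (nat \<Rightarrow> 'u)) set" where
  "srel n U h = {(y, z) \<in> points n U \<times> points n U. \<forall>a\<in>{1..n}. y a \<noteq> z a \<longleftrightarrow> a \<in> h}"

definition adj :: "nat \<Rightarrow> (nat \<Rightarrow> 'u set) \<Rightarrow> nat set \<Rightarrow> (nat \<Rightarrow> 'u, 'f::field) mat" where
  "adj n U h = (\<lambda>y z. of_bool ((y, z) \<in> srel n U h))"

definition dual_idem ::
    "nat \<Rightarrow> (nat \<Rightarrow> 'u set) \<Rightarrow> (nat \<Rightarrow> 'u) \<Rightarrow> nat set \<Rightarrow> (nat \<Rightarrow> 'u, 'f::field) mat" where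
  "dual_idem n U x h = (\<lambda>y z. of_bool (y = z \<and> (x, y) \<in> srel n U h))"

definition terwilliger ::
    "nat \<Rightarrow> (nat \<Rightarrow> 'u set) \<Rightarrow> (nat \<Rightarrow> 'u) \<Rightarrow> (nat \<Rightarrow> 'u, 'f::field) mat set" where
  "terwilliger n U x =
     is_subalgebra (points n U) hull (adj n U ` Pow {1..n} \<union> dual_idem n U x ` Pow {1..n})"


section \<open>The elements B, C and D\<close>

definition kval :: "(nat \<Rightarrow> 'u set) \<Rightarrow> nat set \<Rightarrow> nat" where
  "kval U h = (\<Prod>a\<in>h. card (U a) - 1)"

definition circ_part :: "(nat \<Rightarrow> 'u set) \<Rightarrow> nat set \<Rightarrow> nat set" where
  "circ_part U V = {a \<in> V. card (U a) \<noteq> 2}"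

definition plus_part :: "nat \<Rightarrow> (nat \<Rightarrow> 'u set) \<Rightarrow> nat set \<Rightarrow> nat set" where
  "plus_part p U V = {a \<in> V. p dvd card (U a) - 1}"

definition minus_part :: "nat \<Rightarrow> (nat \<Rightarrow> 'u set) \<Rightarrow> nat set \<Rightarrow> nat set" where
  "minus_part p U V = {a \<in> V. card (U a) \<noteq> 2 \<and> \<not> p dvd card (U a) - 1}"

definition ptriples :: "nat \<Rightarrow> (nat \<Rightarrow> 'u set) \<Rightarrow> (nat set \<times> nat set \<times> nat set) set" where
  "ptriples n U = {(a, b, c) \<in> Pow {1..n} \<times> Pow {1..n} \<times> Pow {1..n}.
     sym_diff a c \<subseteq> b \<and> b \<subseteq> sym_diff a c \<union> circ_part U (a \<inter> c)}"

definition Bmat :: "nat \<Rightarrow> (nat \<Rightarrow> 'u set) \<Rightarrow> (nat \<Rightarrow> 'u) \<Rightarrow> nat set \<Rightarrow> nat set \<Rightarrow> nat set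
    \<Rightarrow> (nat \<Rightarrow> 'u, 'f::field) mat" where
  "Bmat n U x a b c =
     (\<Sum>j \<in> {j. sym_diff a c \<subseteq> j \<and> j \<subseteq> b}.
        mmul (points n U) (mmul (points n U) (dual_idem n U x a) (adj n U j)) (dual_idem n U x c))"

definition Cmat :: "nat \<Rightarrow> (nat \<Rightarrow> 'u set) \<Rightarrow> (nat \<Rightarrow> 'u) \<Rightarrow> nat set
    \<Rightarrow> (nat \<Rightarrow> 'u, 'f::field) mat" where
  "Cmat n U x a =
     (\<Sum>j \<in> Pow {1..n}. msmult (of_nat (kval U (a - j))) (Bmat n U x j (a \<inter> j) j))"

definition Dmat :: "nat \<Rightarrow> (nat \<Rightarrow> 'u set) \<Rightarrow> (nat \<Rightarrow> 'u) \<Rightarrow> nat set \<Rightarrow> nat set \<Rightarrow> nat set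
    \<Rightarrow> (nat \<Rightarrow> 'u, 'f::field) mat" where
  "Dmat n U x a b c =
     (\<Sum>q \<in> {q \<in> Pow {1..n}. b \<subseteq> q \<and> q \<subseteq> sym_diff a c \<union> circ_part U (a \<inter> c)
               \<and> \<not> CHAR('f) dvd kval U q}.
        msmult ((- 1) ^ card (q - b) * inverse (of_nat (kval U (c \<inter> q)))) (Bmat n U x a q c))"

definition dtriples ::
    "nat \<Rightarrow> nat \<Rightarrow> (nat \<Rightarrow> 'u set) \<Rightarrow> (nat set \<times> nat set \<times> nat set) set" where
  "dtriples p n U = {(a, b, c) \<in> ptriples n U. a = c \<and> \<not> p dvd kval U b}"

definition drel :: "nat \<Rightarrow> nat \<Rightarrow> (nat \<Rightarrow> 'u set)
    \<Rightarrow> ((nat set \<times> nat set \<times> nat set) \<times> (nat set \<times> nat set \<times> nat set)) set" where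
  "drel p n U = {((a, b, c), (a', b', c')). (a, b, c) \<in> dtriples p n U \<and>
     (a', b', c') \<in> dtriples p n U \<and> minus_part p U a - b = minus_part p U a' - b'}"

definition dclasses ::
    "nat \<Rightarrow> nat \<Rightarrow> (nat \<Rightarrow> 'u set) \<Rightarrow> (nat set \<times> nat set \<times> nat set) set set" where
  "dclasses p n U = dtriples p n U // drel p n U"

definition block_idem :: "nat \<Rightarrow> (nat \<Rightarrow> 'u set) \<Rightarrow> (nat \<Rightarrow> 'u)
    \<Rightarrow> (nat set \<times> nat set \<times> nat set) set \<Rightarrow> (nat \<Rightarrow> 'u, 'f::field) mat" where
  "block_idem n U x S = (\<Sum>(a, b, c)\<in>S. Dmat n U x a b c)"

definition block_alg :: "nat \<Rightarrow> (nat \<Rightarrow> 'u set) \<Rightarrow> (nat \<Rightarrow> 'u)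
    \<Rightarrow> (nat set \<times> nat set \<times> nat set) set \<Rightarrow> (nat \<Rightarrow> 'u, 'f::field) mat set" where
  "block_alg n U x S =
     (\<lambda>A. mmul (points n U) A (block_idem n U x S)) ` terwilliger n U x"

text \<open>
  The number of classes is as expected, so that enumerations of them by
  \<open>{1..2 ^ card (minus_part p U {1..n})}\<close> exist; the characteristic of a field is never 1.
\<close>

lemma equiv_drel: "equiv (dtriples p n U) (drel p n U)"
  by (auto simp: equiv_def refl_on_def sym_on_def trans_on_def drel_def)

lemma card_dclasses:
  assumes "p \<noteq> 1"
  shows "card (dclasses p n U) = 2 ^ card (minus_part p U {1..n})"
proof -
  let ?f = "\<lambda>(a, b, c :: nat set). minus_part p U a - b"
  let ?D = "dtriples p n U" and ?M = "minus_part p U {1..n}"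
  let ?G = "\<lambda>v. {t \<in> ?D. ?f t = v}"
  have im: "?f ` ?D = Pow ?M"
  proof
    show "?f ` ?D \<subseteq> Pow ?M"
      by (auto simp: dtriples_def ptriples_def minus_part_def)
    show "Pow ?M \<subseteq> ?f ` ?D"
    proof
      fix s assume s: "s \<in> Pow ?M"
      have "(s, {}, s) \<in> ?D"
        using s assms by (auto simp: dtriples_def ptriples_def kval_def minus_part_def)
      moreover have "?f (s, {}, s) = s"
        using s by (auto simp: minus_part_def)
      ultimately show "s \<in> ?f ` ?D"
        by (metis (no_types, lifting) image_eqI)
    qed
  qed
  have cls: "drel p n U `` {t} = ?G (?f t)" if "t \<in> ?D" for t
    using that by (auto simp: drel_def)
  have "dclasses p n U = (\<lambda>t. drel p n U `` {t}) ` ?D"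
    by (auto simp: dclasses_def quotient_def)
  also have "\<dots> = (\<lambda>t. ?G (?f t)) ` ?D"
    using cls by (rule image_cong[OF refl])
  also have "\<dots> = ?G ` (?f ` ?D)"
    by (simp only: image_image)
  finally have "dclasses p n U = ?G ` (?f ` ?D)" .
  moreover have "inj_on ?G (?f ` ?D)"
  proof (rule inj_onI)
    fix v w assume v: "v \<in> ?f ` ?D" and eq: "?G v = ?G w"
    from v obtain t where "t \<in> ?G v" by blast
    with eq show "v = w" by blast
  qed
  moreover have "finite ?M"
    by (rule finite_subset[of _ "{1..n}"]) (auto simp: minus_part_def)
  ultimately show ?thesis
    by (simp only: card_image im card_Pow)
qed

end

theory Submission
  imports
    Defs
    "HOL-Combinatorics.Permutations"
begin

text \<open>
  The algebra \<open>T\<close> is the tensor product over the coordinates \<open>i\<close> of the Terwilliger algebras of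
  one-class schemes. The center of the \<open>i\<close>-th factor is spanned by \<open>1\<close> and by the block matrix
  \<open>cl i\<close> with blocks \<open>k\<^sub>i\<close> (at the base point) and the all-ones matrix (elsewhere), where
  \<open>k\<^sub>i = |U\<^sub>i| - 1\<close>; it satisfies \<open>cl\<^sup>2 = k\<^sub>i cl\<close>. So \<open>C\<^sub>a\<close> is the product of the \<open>cl i\<close> with \<open>i \<in> a\<close>,
  and the block idempotents are products of \<open>cl / k\<^sub>i\<close> or \<open>1 - cl / k\<^sub>i\<close> over the coordinates with
  \<open>k\<^sub>i \<noteq> 0\<close> in the field and \<open>|U\<^sub>i| \<noteq> 2\<close>. In a block, the remaining \<open>cl i\<close> with \<open>k\<^sub>i = 0\<close> generate the center
  as independent commuting elements of square zero, from which the radical and its nilpotent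
  index are read off.
\<close>

subsection \<open>Matrix multiplication\<close>

text \<open>\<open>T\<close> is given only by generators, so the upper bound on its center has to do
  without a basis of \<open>T\<close> and without a decomposition of \<open>T\<close> into a tensor
  product of algebras. Two facts supply it. The permutations of each \<open>U i\<close> that fix
  \<open>x i\<close> preserve every generator, so at the generic entries, where both points differ
  from \<open>x\<close> in all coordinates, an element of \<open>T\<close> depends only on where the
  two points differ. And a matrix on \<open>X\<close> that commutes with \<open>T\<close> is
  determined by its generic entries, whatever the characteristic. Matching them with products of the
  \<open>cl i - 1\<close> therefore recovers every central element. On a coordinate with two points
  \<open>cl i\<close> is the identity and \<open>k i = 1\<close>, so that it belongs neither to the
  plus nor to the minus part. Inside a block, independence of the surviving monomials reduces to one
  nonzero entry of the top monomial, because every monomial divides it.\<close>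

lemma sum_mat_apply: "(\<Sum>i\<in>I. f i) y z = (\<Sum>i\<in>I. f i y z)"
  for f :: "'k \<Rightarrow> ('i, 'f::field) mat"
  by (induction I rule: infinite_finite_induct) auto

lemma mmul_assoc: "mmul X (mmul X A B) C = mmul X A (mmul X B C)"
  unfolding mmul_def fun_eq_iff sum_distrib_left sum_distrib_right
  by (intro allI, subst sum.swap) (simp add: mult.assoc)

lemma mmul_add_left: "mmul X (A + B) C = mmul X A C + mmul X B C"
  and mmul_add_right: "mmul X A (B + C) = mmul X A B + mmul X A C"
  by (simp_all add: mmul_def fun_eq_iff algebra_simps sum.distrib)

lemma mmul_diff_left: "mmul X (A - B) C = mmul X A C - mmul X B C"
  and mmul_diff_right: "mmul X A (B - C) = mmul X A B - mmul X A C"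
  by (simp_all add: mmul_def fun_eq_iff algebra_simps sum_subtractf)

lemma mmul_smult_left: "mmul X (msmult c A) B = msmult c (mmul X A B)"
  and mmul_smult_right: "mmul X A (msmult c B) = msmult c (mmul X A B)"
  by (simp_all add: mmul_def msmult_def fun_eq_iff algebra_simps sum_distrib_left)

lemma mmul_zero_left [simp]: "mmul X 0 A = 0"
  and mmul_zero_right [simp]: "mmul X A 0 = 0"
  by (simp_all add: mmul_def fun_eq_iff)

lemma mmul_sum_left: "mmul X (\<Sum>i\<in>I. f i) A = (\<Sum>i\<in>I. mmul X (f i) A)"
  by (intro ext) (simp add: mmul_def sum_mat_apply sum_distrib_right, rule sum.swap)

lemma mmul_sum_right: "mmul X A (\<Sum>i\<in>I. f i) = (\<Sum>i\<in>I. mmul X A (f i))"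
  by (intro ext) (simp add: mmul_def sum_mat_apply sum_distrib_left, rule sum.swap)

lemma mmul_one_right: "mmul X A (mone X) = A" if "A \<in> mats X" "finite X"
proof (intro ext)
  fix y z
  have "mmul X A (mone X) y z = (\<Sum>w\<in>X. if w = z then A y z else 0)"
    unfolding mmul_def mone_def by (intro sum.cong) auto
  then show "mmul X A (mone X) y z = A y z"
    using that by (auto simp: sum.delta mats_def)
qed

lemma mmul_one_left: "mmul X (mone X) A = A" if "A \<in> mats X" "finite X"
proof (intro ext)
  fix y z
  have "mmul X (mone X) A y z = (\<Sum>w\<in>X. if y = w then A y z else 0)"
    unfolding mmul_def mone_def by (intro sum.cong) auto
  then show "mmul X (mone X) A y z = A y z"
    using that by (auto simp: sum.delta' mats_def)
qed

lemma mmul_mats: "mmul X A B \<in> mats X" if "A \<in> mats X" "B \<in> mats X"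
  using that by (auto simp: mmul_def mats_def)

lemma subspace_mats: "mat.subspace (mats X)"
  unfolding mat.subspace_def by (auto simp: mats_def msmult_def)

text \<open>Bilinearity is used one factor at a time: for a fixed generator on the left the
  admissible right factors form a subspace, and then so do the left factors for the given
  \<open>B\<close>.\<close>

lemma mmul_span:
  assumes "\<And>A B. A \<in> S \<Longrightarrow> B \<in> T \<Longrightarrow> mmul X A B \<in> mat.span R"
    and "A \<in> mat.span S" "B \<in> mat.span T"
  shows "mmul X A B \<in> mat.span R"
proof -
  have right: "mmul X A' B \<in> mat.span R" if A': "A' \<in> S" for A'
  proof -
    have "mat.span T \<subseteq> {B. mmul X A' B \<in> mat.span R}"
      using assms(1)[OF A'] by (intro mat.span_minimal)
        (auto simp: mat.subspace_def mmul_add_right mmul_smult_right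
          intro: mat.span_zero mat.span_add mat.span_scale)
    then show ?thesis using assms(3) by blast
  qed
  have "mat.span S \<subseteq> {A. mmul X A B \<in> mat.span R}"
    using right by (intro mat.span_minimal)
      (auto simp: mat.subspace_def mmul_add_left mmul_smult_left
        intro: mat.span_zero mat.span_add mat.span_scale)
  then show ?thesis using assms(2) by blast
qed

lemma is_subalgebra_mats: "is_subalgebra X (mats X)"
  unfolding is_subalgebra_def by (auto simp: subspace_mats mmul_mats) (auto simp: mone_def mats_def)

lemma is_subalgebra_Inter:
  assumes "\<S> \<noteq> {}" and sub: "\<And>S. S \<in> \<S> \<Longrightarrow> is_subalgebra X S"
  shows "is_subalgebra X (\<Inter>\<S>)"
proof -
  obtain S where "S \<in> \<S>" using assms(1) by blast
  with sub have "\<Inter>\<S> \<subseteq> mats X"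
    by (intro Inf_lower2[of S]) (simp_all add: is_subalgebra_def)
  moreover have "mat.subspace (\<Inter>\<S>)"
    using sub by (intro mat.subspace_Inter) (simp add: is_subalgebra_def)
  ultimately show ?thesis
    using sub by (simp add: is_subalgebra_def)
qed

text \<open>A hull is an intersection, and an empty one would be the whole function type;
  \<open>mats X\<close> is a member of the family.\<close>

lemma is_subalgebra_hull: "is_subalgebra X (is_subalgebra X hull S)" if "S \<subseteq> mats X"
  unfolding hull_def using that is_subalgebra_mats by (intro is_subalgebra_Inter) auto

text \<open>Reduces commuting with a generated algebra to commuting with its generators.\<close>

lemma is_subalgebra_centralizer: "is_subalgebra X {A \<in> mats X. mmul X A Z = mmul X Z A}"
  if "Z \<in> mats X" "finite X"
proof -
  have "mmul X (mmul X A B) Z = mmul X Z (mmul X A B)"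
    if "mmul X A Z = mmul X Z A" "mmul X B Z = mmul X Z B" for A B
    using that by (metis mmul_assoc)
  moreover have "mone X \<in> mats X"
    by (auto simp: mone_def mats_def)
  ultimately show ?thesis
    using that subspace_mats[of X]
    by (auto simp: is_subalgebra_def mat.subspace_def mmul_mats mmul_one_left mmul_one_right
       mmul_add_left mmul_add_right mmul_smult_left mmul_smult_right)
qed


subsection \<open>Algebras spanned by square-free monomials\<close>

text \<open>An abstract copy of \<open>F[w]/(w^2)\<close> with one variable \<open>w\<close> for
  each element of \<open>W\<close>: \<open>c a\<close> stands for the product of the variables in
  \<open>a\<close>, and \<open>c {}\<close> is the unit, which may differ from
  \<open>mone X\<close>. The condition on \<open>c W\<close> excludes a collapse, since every
  monomial divides the top one.\<close>

locale squarefree_monomials =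
  fixes X :: "'i set" and W :: "'w set" and c :: "'w set \<Rightarrow> ('i, 'f::field) mat"
  assumes finX: "finite X" and finW: "finite W"
    and c_mats: "a \<subseteq> W \<Longrightarrow> c a \<in> mats X"
    and c_mult: "a \<subseteq> W \<Longrightarrow> b \<subseteq> W \<Longrightarrow>
      mmul X (c a) (c b) = (if a \<inter> b = {} then c (a \<union> b) else 0)"
    and c_top: "c W \<noteq> 0"
begin

text \<open>A minimal monomial with nonzero coefficient is isolated by multiplying with the complementary one.\<close>

lemma coeff_zero:
  assumes "(\<Sum>a\<in>Pow W. msmult (u a) (c a)) = 0" and "a \<subseteq> W"
  shows "u a = 0"
proof (rule ccontr)
  assume "u a \<noteq> 0"
  define S where "S = {a \<in> Pow W. u a \<noteq> 0}"
  have "a \<in> S" "finite S"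
    using \<open>u a \<noteq> 0\<close> assms(2) finW by (simp_all add: S_def)
  then obtain m where "m \<in> S" and "\<forall>b\<in>S. b \<subseteq> m \<longrightarrow> m = b"
    using finite_has_minimal[of S] by (metis empty_iff)
  then have m: "m \<subseteq> W" "u m \<noteq> 0"
    and min: "\<And>b. b \<subseteq> W \<Longrightarrow> u b \<noteq> 0 \<Longrightarrow> b \<subseteq> m \<Longrightarrow> m = b"
    by (simp_all add: S_def)
  have "0 = mmul X (\<Sum>a\<in>Pow W. msmult (u a) (c a)) (c (W - m))"
    using assms(1) by simp
  also have "\<dots> = (\<Sum>a\<in>Pow W. msmult (u a) (mmul X (c a) (c (W - m))))"
    by (simp add: mmul_sum_left mmul_smult_left)
  also have "\<dots> = (\<Sum>a\<in>Pow W. if a = m then msmult (u m) (c W) else 0)"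
  proof (rule sum.cong)
    fix a assume "a \<in> Pow W"
    show "msmult (u a) (mmul X (c a) (c (W - m))) = (if a = m then msmult (u m) (c W) else 0)"
    proof (cases "a \<inter> (W - m) = {}")
      case True
      then have "a \<subseteq> m" using \<open>a \<in> Pow W\<close> by blast
      show ?thesis
      proof (cases "a = m")
        case True
        then show ?thesis using m c_mult[of m "W - m"] by (auto simp: Un_absorb1)
      next
        case False
        then have "u a = 0" using min \<open>a \<subseteq> m\<close> \<open>a \<in> Pow W\<close> by blast
        then show ?thesis using False by simp
      qed
    next
      case False
      then have "mmul X (c a) (c (W - m)) = 0" using \<open>a \<in> Pow W\<close> by (auto simp: c_mult)
      then show ?thesis using False by auto
    qed
  qed simp
  also have "\<dots> = msmult (u m) (c W)"
    using m finW by (simp add: sum.delta)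
  finally show False
    using m(2) c_top by (metis mat.scale_eq_0_iff)
qed

text \<open>Independence of an image set would not notice two equal monomials, so injectivity is
  settled separately; the dimension count rests on it.\<close>

lemma inj_on_c: "inj_on c (Pow W)"
proof (rule inj_onI, rule ccontr)
  fix a b assume ab: "a \<in> Pow W" "b \<in> Pow W" "c a = c b" "a \<noteq> b"
  let ?u = "\<lambda>d. of_bool (d = a) - of_bool (d = b) :: 'f"
  have "(\<Sum>d\<in>Pow W. msmult (?u d) (c d))
      = (\<Sum>d\<in>Pow W. (if d = a then c a else 0) - (if d = b then c b else 0))"
    by (intro sum.cong) (auto simp: mat.scale_left_diff_distrib)
  also have "\<dots> = 0"
    using ab finW by (simp add: sum_subtractf sum.delta)
  finally show False
    using coeff_zero[of ?u a] ab by auto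
qed

lemma independent_c: "mat.independent (c ` S)" if "S \<subseteq> Pow W"
proof -
  have "mat.independent (c ` Pow W)"
  proof -
    have "finite (c ` Pow W)" using finW by simp
    moreover have "u v = 0" if "(\<Sum>v\<in>c ` Pow W. msmult (u v) v) = 0" "v \<in> c ` Pow W" for u v
      using that coeff_zero[of "\<lambda>a. u (c a)"] by (auto simp: sum.reindex[OF inj_on_c])
    ultimately show ?thesis
      using mat.dependent_finite by blast
  qed
  then show ?thesis
    by (rule mat.independent_mono) (use that in blast)
qed

lemma is_basis_c: "is_basis (c ` S) (mat.span (c ` S))" if "S \<subseteq> Pow W"
  using independent_c[OF that] by (simp add: is_basis_def)

lemma dim_c: "mat.dim (mat.span (c ` S)) = card S" if "S \<subseteq> Pow W"
  using mat.dim_eq_card_independent[OF independent_c[OF that]] that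
  by (simp add: card_image inj_on_subset[OF inj_on_c])

section \<open>Filtration by degree\<close>

abbreviation Z where "Z \<equiv> mat.span (c ` Pow W)"

text \<open>The \<open>t\<close>-th power of the ideal generated by the variables.
  \<open>level 1\<close> turns out to be the radical, and multiplication moves down the filtration
  until the degree exceeds \<open>card W\<close>.\<close>

abbreviation level where "level t \<equiv> mat.span (c ` {a \<in> Pow W. t \<le> card a})"

lemma span_mats: "S \<subseteq> Pow W \<Longrightarrow> mat.span (c ` S) \<subseteq> mats X"
  using c_mats by (intro mat.span_minimal subspace_mats) auto

text \<open>Disjoint supports add their degrees; overlapping ones multiply to zero, which lies in
  every level.\<close>

lemma mmul_level: "mmul X A B \<in> level (s + t)" if "A \<in> level s" "B \<in> level t"
proof (rule mmul_span[OF _ that])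
  fix A B assume "A \<in> c ` {a \<in> Pow W. s \<le> card a}" "B \<in> c ` {a \<in> Pow W. t \<le> card a}"
  then obtain a b where ab: "A = c a" "B = c b" "a \<subseteq> W" "b \<subseteq> W" "s \<le> card a" "t \<le> card b"
    by auto
  show "mmul X A B \<in> level (s + t)"
  proof (cases "a \<inter> b = {}")
    case True
    then have "card (a \<union> b) = card a + card b"
      using ab finW by (intro card_Un_disjoint) (auto intro: finite_subset)
    then show ?thesis
      using True ab by (auto simp: c_mult intro!: mat.span_base)
  next
    case False
    then show ?thesis using ab by (simp add: c_mult mat.span_zero)
  qed
qed

lemma level_0: "level 0 = Z"
  by (simp add: Pow_def)

lemma level_mono: "s \<le> t \<Longrightarrow> level t \<subseteq> level s"
  by (intro mat.span_mono) auto

lemma level_top: "level (Suc (card W)) = {0}"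
proof -
  have "{a \<in> Pow W. Suc (card W) \<le> card a} = {}"
    using card_mono[OF finW] by (auto simp: Suc_le_eq not_less)
  then show ?thesis by (simp only: image_empty mat.span_empty)
qed

lemma level_1: "level 1 = mat.span (c ` (Pow W - {{}}))"
proof -
  have "{a \<in> Pow W. 1 \<le> card a} = Pow W - {{}}"
    using finW by (auto simp: Suc_le_eq card_gt_0_iff dest: finite_subset)
  then show ?thesis by simp
qed

lemma unit_left: "A \<in> Z \<Longrightarrow> mmul X (c {}) A = A"
proof -
  assume "A \<in> Z"
  moreover have "Z \<subseteq> {A. mmul X (c {}) A = A}"
    by (intro mat.span_minimal)
      (auto simp: c_mult mat.subspace_def mmul_add_right mmul_smult_right)
  ultimately show ?thesis by blast
qed

lemma commute: "mmul X A B = mmul X B A" if "A \<in> Z" "B \<in> Z"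
proof -
  have 1: "mmul X A' B = mmul X B A'" if "A' \<in> c ` Pow W" for A'
  proof -
    have "Z \<subseteq> {B. mmul X A' B = mmul X B A'}"
      using that by (intro mat.span_minimal)
        (auto simp: c_mult mat.subspace_def mmul_add_right mmul_smult_right
          mmul_add_left mmul_smult_left Int_commute Un_commute)
    then show ?thesis using \<open>B \<in> Z\<close> by blast
  qed
  have "Z \<subseteq> {A. mmul X A B = mmul X B A}"
    using 1 by (intro mat.span_minimal)
      (auto simp: mat.subspace_def mmul_add_right mmul_smult_right
        mmul_add_left mmul_smult_left)
  then show ?thesis using \<open>A \<in> Z\<close> by blast
qed

lemma unit_notin: "c {} \<notin> level 1"
proof
  assume "c {} \<in> level 1"
  then have "c {} \<in> mat.span (c ` Pow W - {c {}})"
    using inj_on_c unfolding level_1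
    by (elim rev_subsetD) (intro mat.span_mono, auto dest: inj_onD)
  then show False
    using independent_c[of "Pow W"] by (auto simp: mat.dependent_def)
qed

text \<open>\<open>level 1\<close> is the augmentation ideal: modulo it only multiples of the unit
  remain.\<close>

lemma decompose: "\<exists>r m. A = msmult r (c {}) + m \<and> m \<in> level 1" if A: "A \<in> Z"
proof -
  have "c ` Pow W = insert (c {}) (c ` (Pow W - {{}}))"
    by auto
  then obtain r where "A - msmult r (c {}) \<in> level 1"
    using A mat.span_breakdown_eq[of A "c {}" "c ` (Pow W - {{}})"]
    unfolding level_1 by auto
  moreover have "A = msmult r (c {}) + (A - msmult r (c {}))" by simp
  ultimately show ?thesis by blast
qed

text \<open>If \<open>r c {} + m\<close> with \<open>r \<noteq> 0\<close> lies in an ideal, then multiplying by powers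
  of the nilpotent \<open>m\<close> puts all of these, from the highest down to the unit, into the ideal.\<close>

lemma proper_ideal_subset:
  assumes I: "left_ideal X Z I" "I \<noteq> Z"
  shows "I \<subseteq> level 1"
proof (rule ccontr)
  assume "\<not> I \<subseteq> level 1"
  then obtain A where A: "A \<in> I" "A \<notin> level 1" by blast
  have sub: "mat.subspace I" and IZ: "I \<subseteq> Z" and mulI: "\<And>b i. b \<in> Z \<Longrightarrow> i \<in> I \<Longrightarrow> mmul X b i \<in> I"
    using I by (auto simp: left_ideal_def)
  obtain r m where rm: "A = msmult r (c {}) + m" "m \<in> level 1"
    using decompose A IZ by blast
  have r: "r \<noteq> 0"
    using A(2) rm by auto
  have mZ: "m \<in> Z" using rm(2) level_mono[of 0 1] level_0 by auto
  have cZ: "c {} \<in> Z" by (intro mat.span_base) auto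
  define P where "P t = ((mmul X m) ^^ t) (c {})" for t
  have P_level: "P t \<in> level t" for t
  proof (induction t)
    case 0
    then show ?case using cZ unfolding P_def level_0 by simp
  next
    case (Suc t)
    then show ?case using mmul_level[OF rm(2), of _ t] by (simp add: P_def)
  qed
  then have PZ: "P t \<in> Z" for t
    using level_mono[of 0 t] level_0 by auto
  have "P (Suc (card W)) \<in> I"
    using P_level[of "Suc (card W)"] mat.subspace_0[OF sub] unfolding level_top by simp
  \<comment> \<open>\<open>m^t A = r m^t + m^(t+1)\<close>, and \<open>r\<close> is
    invertible.\<close>
  moreover have "P t \<in> I" if "P (Suc t) \<in> I" for t
  proof -
    have "mmul X (P t) A = msmult r (P t) + P (Suc t)"
      using unit_left[OF PZ] commute[OF PZ cZ] commute[OF PZ mZ]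
      by (simp add: rm(1) mmul_add_right mmul_smult_right P_def)
    then have "msmult r (P t) = mmul X (P t) A - P (Suc t)"
      by simp
    also have "\<dots> \<in> I"
      using mulI[OF PZ A(1)] that sub by (intro mat.subspace_diff)
    finally have "msmult (inverse r) (msmult r (P t)) \<in> I"
      using sub by (rule mat.subspace_scale[rotated])
    then show ?thesis using r by simp
  qed
  \<comment> \<open>The induction descends from \<open>Suc (card W)\<close>, where the power of
    \<open>m\<close> is zero, to 0, where it is the unit.\<close>
  ultimately have "P 0 \<in> I"
    by (rule inc_induct[of 0 "Suc (card W)" "\<lambda>t. P t \<in> I", rotated]) auto
  then have "c {} \<in> I" by (simp add: P_def)
  then have "B \<in> I" if "B \<in> Z" for B
    using mulI[OF that] commute[OF that cZ] unit_left[OF that] by metis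
  with I(2) IZ show False by blast
qed

lemma left_ideal_level_1: "left_ideal X Z (level 1)"
  unfolding left_ideal_def
  using level_mono[of 0 1] mmul_level[of _ 0 _ 1] level_0 by auto

lemma level_1_neq: "level 1 \<noteq> Z"
  using unit_notin by (metis Pow_bottom image_eqI mat.span_base)

text \<open>All proper left ideals lie in \<open>level 1\<close>, which is itself proper: the
  algebra is local, and the intersection runs over a single maximal ideal.\<close>

lemma jacobson_radical_Z: "jacobson_radical X Z = level 1"
proof -
  have "I = level 1" if "maximal_left_ideal X Z I" for I
  proof -
    have "I \<subseteq> level 1" using that proper_ideal_subset by (auto simp: maximal_left_ideal_def)
    with that left_ideal_level_1 level_1_neq show ?thesis
      by (auto simp: maximal_left_ideal_def)
  qed
  moreover have "maximal_left_ideal X Z (level 1)"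
    unfolding maximal_left_ideal_def
    using left_ideal_level_1 level_1_neq proper_ideal_subset by blast
  ultimately have "{I. maximal_left_ideal X Z I} = {level 1}"
    by blast
  moreover have "jacobson_radical X Z = Z \<inter> \<Inter>{I. maximal_left_ideal X Z I}"
    by (simp add: jacobson_radical_def Int_def)
  ultimately show ?thesis
    using level_mono[of 0 1] level_0 by (simp add: Int_absorb1)
qed

text \<open>The list has to be nonempty because the empty product is \<open>mone X\<close>, which
  need not belong to \<open>Z\<close>; behind a last factor that \<open>mone X\<close> is
  absorbed.\<close>

lemma products_level:
  assumes "set As \<subseteq> level 1" "As \<noteq> []"
  shows "foldr (mmul X) As (mone X) \<in> level (length As)"
  using assms
proof (induction As)
  case (Cons A As)
  show ?case
  proof (cases "As = []")
    case True
    have "A \<in> mats X"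
      using Cons.prems span_mats[of "{a \<in> Pow W. 1 \<le> card a}"] by auto
    then show ?thesis
      using True Cons.prems finX by (simp add: mmul_one_right)
  next
    case False
    then show ?thesis
      using Cons mmul_level[of A 1 _ "length As"] by simp
  qed
qed simp

text \<open>The witness that the nilpotent index is not smaller: different variables multiply to a
  monomial.\<close>

lemma products_singletons:
  assumes "distinct ws" "ws \<noteq> []" "set ws \<subseteq> W"
  shows "foldr (mmul X) (map (\<lambda>w. c {w}) ws) (mone X) = c (set ws)"
  using assms
proof (induction ws)
  case (Cons w ws)
  show ?case
  proof (cases "ws = []")
    case True
    then show ?thesis
      using Cons.prems finX by (simp add: mmul_one_right c_mats)
  next
    case False
    then show ?thesis
      using Cons by (simp add: c_mult)
  qed
qed simp

lemma c_nonzero: "a \<subseteq> W \<Longrightarrow> c a \<noteq> 0"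
  using c_top c_mult[of a "W - a"] by (auto simp: Un_absorb1)

lemma has_nilpotent_index_level_1: "has_nilpotent_index X (level 1) (card W + 1)"
  unfolding has_nilpotent_index_def
proof (intro conjI allI impI)
  show "products_vanish X (level 1) (card W + 1)"
    unfolding products_vanish_def
  proof (intro allI impI)
    fix As assume As: "length As = card W + 1 \<and> set As \<subseteq> level 1"
    then have "As \<noteq> []" by auto
    from products_level[OF _ this] As level_top show "foldr (mmul X) As (mone X) = 0"
      by auto
  qed
next
  fix s assume s: "1 \<le> s \<and> s < card W + 1"
  \<comment> \<open>As \<open>s\<close> is at most \<open>card W\<close>, there is room for
    \<open>s\<close> different variables, and their product \<open>c V\<close> is nonzero.\<close>
  then obtain V where V: "V \<subseteq> W" "card V = s"
    by (metis Suc_eq_plus1 less_Suc_eq_le obtain_subset_with_card_n)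
  then obtain ws where ws: "set ws = V" "distinct ws"
    using finite_distinct_list finW finite_subset by metis
  let ?As = "map (\<lambda>w. c {w}) ws"
  have "length ?As = s" "ws \<noteq> []"
    using ws V s distinct_card[of ws] by auto
  moreover have "set ?As \<subseteq> level 1"
    using ws V by (auto intro!: mat.span_base imageI)
  moreover have "foldr (mmul X) ?As (mone X) \<noteq> 0"
    using products_singletons[of ws] ws V \<open>ws \<noteq> []\<close> c_nonzero by auto
  ultimately show "\<not> products_vanish X (level 1) s"
    unfolding products_vanish_def by blast
qed simp

end

subsection \<open>Tensor products\<close>

text \<open>The Kronecker product of one matrix per coordinate; the guard makes it vanish off
  \<open>X \<times> X\<close>, as \<open>mats\<close> demands.\<close>

definition tens :: "nat \<Rightarrow> (nat \<Rightarrow> 'u set) \<Rightarrow> (nat \<Rightarrow> ('u, 'f::field) mat) \<Rightarrow> (nat \<Rightarrow> 'u, 'f) mat" where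
  "tens n U M = (\<lambda>y z. if y \<in> points n U \<and> z \<in> points n U then \<Prod>i\<in>{1..n}. M i (y i) (z i) else 0)"

lemma prod_of_bool: "(\<Prod>i\<in>A. of_bool (P i)) = (of_bool (\<forall>i\<in>A. P i) :: 'f::field)" if "finite A"
  using that by (induction A rule: finite_induct) auto

lemma points_mem: "y \<in> points n U \<Longrightarrow> i \<in> {1..n} \<Longrightarrow> y i \<in> U i"
  by (auto simp: points_def)

lemma points_eq_iff:
  "y \<in> points n U \<Longrightarrow> z \<in> points n U \<Longrightarrow> y = z \<longleftrightarrow> (\<forall>i\<in>{1..n}. y i = z i)"
  unfolding points_def by (metis PiE_ext)

lemma tens_mats: "tens n U M \<in> mats (points n U)"
  by (auto simp: tens_def mats_def)

lemma tens_cong: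
  assumes "\<And>i s t. i \<in> {1..n} \<Longrightarrow> s \<in> U i \<Longrightarrow> t \<in> U i \<Longrightarrow> M i s t = N i s t"
  shows "tens n U M = tens n U N"
  unfolding tens_def fun_eq_iff using assms by (auto intro!: prod.cong simp: points_mem)

lemma tens_eq_0: "i \<in> {1..n} \<Longrightarrow> M i (y i) (z i) = 0 \<Longrightarrow> tens n U M y z = 0"
  by (auto simp: tens_def intro: prod_zero)

text \<open>A sum over tuples of a product over coordinates factors into the coordinate
  sums.\<close>

lemma mmul_tens:
  assumes "\<And>i. i \<in> {1..n} \<Longrightarrow> finite (U i)"
  shows "mmul (points n U) (tens n U M) (tens n U N) = tens n U (\<lambda>i. mmul (U i) (M i) (N i))"
proof (intro ext)
  fix y z
  show "mmul (points n U) (tens n U M) (tens n U N) y z = tens n U (\<lambda>i. mmul (U i) (M i) (N i)) y z"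
  proof (cases "y \<in> points n U \<and> z \<in> points n U")
    case True
    have "mmul (points n U) (tens n U M) (tens n U N) y z =
        (\<Sum>w\<in>points n U. \<Prod>i\<in>{1..n}. M i (y i) (w i) * N i (w i) (z i))"
      using True by (simp add: mmul_def tens_def prod.distrib)
    also have "\<dots> = (\<Prod>i\<in>{1..n}. \<Sum>v\<in>U i. M i (y i) v * N i v (z i))"
      using assms unfolding points_def by (subst prod_sum_PiE) auto
    finally show ?thesis using True by (simp add: tens_def mmul_def)
  next
    case False
    then show ?thesis by (auto simp: mmul_def tens_def)
  qed
qed

lemma adj_eq_tens: "adj n U h = tens n U (\<lambda>i s t. of_bool ((s \<noteq> t) = (i \<in> h)))"
  unfolding adj_def srel_def tens_def prod_of_bool[OF finite_atLeastAtMost]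
  by (intro ext) (simp, blast)

lemma dual_idem_eq_tens:
  "dual_idem n U x h = tens n U (\<lambda>i s t. of_bool (s = t \<and> (x i \<noteq> s) = (i \<in> h)))"
  if "x \<in> points n U"
proof (intro ext)
  fix y z
  show "dual_idem n U x h y z = tens n U (\<lambda>i s t. of_bool (s = t \<and> (x i \<noteq> s) = (i \<in> h))) y z"
  proof (cases "y \<in> points n U \<and> z \<in> points n U")
    case True
    then have "y = z \<longleftrightarrow> (\<forall>i\<in>{1..n}. y i = z i)"
      by (intro points_eq_iff) auto
    with True that show ?thesis
      unfolding dual_idem_def srel_def tens_def prod_of_bool[OF finite_atLeastAtMost]
      by (simp add: ball_conj_distrib)
  next
    case False
    then show ?thesis by (auto simp: dual_idem_def srel_def tens_def)
  qed
qed


text \<open>Under the stabilizer of \<open>b\<close> in the symmetric group of \<open>V\<close>, the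
  orbit of a pair of points other than \<open>b\<close> is decided by whether the two are
  equal.\<close>

lemma exists_bij_two_points:
  assumes "p \<in> V" "q \<in> V" "p' \<in> V" "q' \<in> V" "p \<noteq> b" "q \<noteq> b" "p' \<noteq> b" "q' \<noteq> b" "p = q \<longleftrightarrow> p' = q'"
  shows "\<exists>\<sigma>. bij_betw \<sigma> V V \<and> \<sigma> b = b \<and> \<sigma> p = p' \<and> \<sigma> q = q'"
proof -
  let ?\<tau> = "Transposition.transpose p p'"
  let ?r = "?\<tau> q"
  \<comment> \<open>After \<open>p\<close> is sent to \<open>p'\<close>, the image \<open>?r\<close>
    of \<open>q\<close> is moved to \<open>q'\<close>. If \<open>p \<noteq> q\<close>, then
    \<open>p'\<close> differs from both \<open>?r\<close> and \<open>q'\<close> and stays put;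
    otherwise \<open>?r = p' = q'\<close> and the second transposition is trivial.\<close>
  let ?\<sigma> = "Transposition.transpose ?r q' \<circ> ?\<tau>"
  have r: "?r \<in> V" "?r \<noteq> b"
    using assms by (auto simp: transpose_def)
  have "?\<sigma> permutes V"
    using assms r by (intro permutes_compose permutes_swap_id)
  then have "bij_betw ?\<sigma> V V"
    by (rule permutes_imp_bij)
  moreover have "?\<sigma> b = b" "?\<sigma> q = q'"
    using assms r by (simp_all add: transpose_def)
  moreover have "?\<sigma> p = p'"
    using assms by (auto simp: transpose_def)
  ultimately show ?thesis by blast
qed


subsection \<open>Central elements of the tensor product\<close>

locale factorial_scheme =
  fixes n :: nat and U :: "nat \<Rightarrow> 'u set" and x :: "nat \<Rightarrow> 'u"
  assumes fin: "i \<in> {1..n} \<Longrightarrow> finite (U i)"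
    and card: "i \<in> {1..n} \<Longrightarrow> 2 \<le> card (U i)"
    and base: "x \<in> points n U"
begin

abbreviation X where "X \<equiv> points n U"

abbreviation T :: "(nat \<Rightarrow> 'u, 'f::field) mat set" where "T \<equiv> terwilliger n U x"

abbreviation k :: "nat \<Rightarrow> 'f::field" where "k i \<equiv> of_nat (card (U i) - 1)"

definition diff_set :: "(nat \<Rightarrow> 'u) \<Rightarrow> (nat \<Rightarrow> 'u) \<Rightarrow> nat set" where
  "diff_set y z = {i \<in> {1..n}. y i \<noteq> z i}"

lemma diff_set_subset: "diff_set y z \<subseteq> {1..n}"
  by (auto simp: diff_set_def)

lemma diff_set_eq_iff:
  "diff_set y z = diff_set y' z' \<longleftrightarrow> (\<forall>i\<in>{1..n}. (y i = z i) = (y' i = z' i))"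
  unfolding diff_set_def by blast

lemma diff_set_subset_iff: "diff_set y z \<subseteq> a \<longleftrightarrow> (\<forall>i\<in>{1..n}. y i \<noteq> z i \<longrightarrow> i \<in> a)"
  by (auto simp: diff_set_def)

lemma srel_iff: "(y, z) \<in> srel n U h \<longleftrightarrow> y \<in> X \<and> z \<in> X \<and> diff_set y z = h" if "h \<subseteq> {1..n}"
proof -
  have "diff_set y z = h \<longleftrightarrow> (\<forall>a\<in>{1..n}. (y a \<noteq> z a) = (a \<in> h))"
    using that unfolding diff_set_def by blast
  then show ?thesis by (simp add: srel_def)
qed

lemma finite_X: "finite X"
  using fin by (auto simp: points_def intro: finite_PiE)

lemma tens_mult: "mmul X (tens n U M) (tens n U N) = tens n U (\<lambda>i. mmul (U i) (M i) (N i))"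
  by (rule mmul_tens) (rule fin)

section \<open>The central matrix of a single coordinate\<close>

lemma base_mem: "i \<in> {1..n} \<Longrightarrow> x i \<in> U i"
  using base by (rule points_mem)

text \<open>The value \<open>k i\<close> at the base point makes all row and column sums equal to
  \<open>k i\<close>, since every other row contains \<open>k i\<close> ones. Equal sums mean that
  \<open>cl i\<close> commutes with the all-ones matrix, hence with the adjacency matrices of the
  coordinate.\<close>

definition cl :: "nat \<Rightarrow> ('u, 'f::field) mat" where
  "cl i = (\<lambda>s t. if s = x i \<and> t = x i then k i else of_bool (s \<noteq> x i \<and> t \<noteq> x i))"

lemma sum_eq_left: "(\<Sum>v\<in>U i. of_bool (s = v) * f v) = (f s :: 'f::field)"
  if "i \<in> {1..n}" "s \<in> U i"
proof -
  have "(\<Sum>v\<in>U i. of_bool (s = v) * f v) = (\<Sum>v\<in>U i. if s = v then f v else 0)"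
    by (intro sum.cong) auto
  then show ?thesis using that fin by simp
qed

lemma sum_eq_right: "(\<Sum>v\<in>U i. f v * of_bool (v = t)) = (f t :: 'f::field)"
  if "i \<in> {1..n}" "t \<in> U i"
  using sum_eq_left[OF that, of f] by (simp add: mult.commute eq_commute[of t])

lemma sum_nonbase: "(\<Sum>v\<in>U i. of_bool (v \<noteq> x i)) = (k i :: 'f::field)" if "i \<in> {1..n}"
proof -
  have "(\<Sum>v\<in>U i. of_bool (v \<noteq> x i)) = (of_nat (card (U i - {x i})) :: 'f)"
    using fin[OF that] by (simp add: sum.If_cases of_bool_def Int_def set_diff_eq)
  then show ?thesis using base_mem[OF that] by simp
qed

lemma cl_row_sum: "(\<Sum>v\<in>U i. cl i s v) = (k i :: 'f::field)" if "i \<in> {1..n}" "s \<in> U i"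
proof (cases "s = x i")
  case True
  then have "(\<Sum>v\<in>U i. cl i s v) = (\<Sum>v\<in>U i. k i * of_bool (v = x i) :: 'f)"
    by (intro sum.cong) (auto simp: cl_def)
  then show ?thesis
    using sum_eq_right[OF that(1) base_mem[OF that(1)], of "\<lambda>_. k i :: 'f"] by simp
next
  case False
  then have "(\<Sum>v\<in>U i. cl i s v) = (\<Sum>v\<in>U i. of_bool (v \<noteq> x i) :: 'f)"
    by (intro sum.cong) (auto simp: cl_def)
  then show ?thesis using sum_nonbase[OF that(1)] by simp
qed

lemma cl_sym: "cl i s t = cl i t s"
  by (auto simp: cl_def)

lemma cl_square: "(\<Sum>v\<in>U i. cl i s v * cl i v t) = (k i * cl i s t :: 'f::field)"
  if "i \<in> {1..n}" "s \<in> U i" "t \<in> U i"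
proof -
  \<comment> \<open>If \<open>s\<close> and \<open>t\<close> lie in different blocks, every term
    vanishes; otherwise the second factor may be replaced by the constant of the block, which leaves
    a row sum.\<close>
  have "cl i s v * cl i v t = (if s = x i \<longleftrightarrow> t = x i then (if s = x i then k i else 1) * cl i s v else (0 :: 'f))" for v
    by (auto simp: cl_def)
  then have "(\<Sum>v\<in>U i. cl i s v * cl i v t) =
      (if s = x i \<longleftrightarrow> t = x i then (if s = x i then k i else 1) * k i else (0 :: 'f))"
    using cl_row_sum[OF that(1,2), where 'f='f] by (auto simp flip: sum_distrib_left)
  then show ?thesis by (auto simp: cl_def)
qed

text \<open>For true \<open>b\<close> the factor is the all-ones matrix minus the identity, and
  symmetry turns the column sum of \<open>cl i\<close> into a row sum; for false \<open>b\<close> it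
  is the identity.\<close>

lemma cl_comm_adj:
  "(\<Sum>v\<in>U i. of_bool ((s \<noteq> v) = b) * cl i v t) = (\<Sum>v\<in>U i. cl i s v * of_bool ((v \<noteq> t) = b) :: 'f::field)"
  if "i \<in> {1..n}" "s \<in> U i" "t \<in> U i"
proof (cases b)
  case True
  have "(\<Sum>v\<in>U i. of_bool ((s \<noteq> v) = b) * cl i v t) = (\<Sum>v\<in>U i. cl i t v - of_bool (s = v) * cl i v t :: 'f)"
    using True by (intro sum.cong) (auto simp: cl_sym)
  moreover have "(\<Sum>v\<in>U i. cl i s v * of_bool ((v \<noteq> t) = b)) = (\<Sum>v\<in>U i. cl i s v - cl i s v * of_bool (v = t) :: 'f)"
    using True by (intro sum.cong) auto
  ultimately show ?thesis
    using that by (simp add: sum_subtractf cl_row_sum sum_eq_left sum_eq_right)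
next
  case False
  then show ?thesis using that by (simp add: sum_eq_left sum_eq_right)
qed

text \<open>\<open>cl i\<close> is block diagonal for the splitting into \<open>x i\<close> and the
  other points, and the dual idempotents project onto these blocks.\<close>

lemma cl_comm_dual:
  "(\<Sum>v\<in>U i. of_bool (s = v \<and> (x i \<noteq> s) = b) * cl i v t) =
   (\<Sum>v\<in>U i. cl i s v * of_bool (v = t \<and> (x i \<noteq> v) = b) :: 'f::field)"
  if "i \<in> {1..n}" "s \<in> U i" "t \<in> U i"
proof -
  have "(\<Sum>v\<in>U i. of_bool (s = v \<and> (x i \<noteq> s) = b) * cl i v t) = (\<Sum>v\<in>U i. of_bool (s = v) * (of_bool ((x i \<noteq> s) = b) * cl i v t) :: 'f)"
    by (intro sum.cong) auto
  moreover have "(\<Sum>v\<in>U i. cl i s v * of_bool (v = t \<and> (x i \<noteq> v) = b)) = (\<Sum>v\<in>U i. (cl i s v * of_bool ((x i \<noteq> v) = b)) * of_bool (v = t) :: 'f)"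
    by (intro sum.cong) auto
  ultimately show ?thesis
    using that by (simp add: sum_eq_left sum_eq_right) (auto simp: cl_def)
qed

text \<open>On the coordinate \<open>i\<close> the matrices below are \<open>\<alpha> i + \<beta> i * cl i\<close>, a central element of the
  one-coordinate Terwilliger algebra.\<close>

definition zmat :: "(nat \<Rightarrow> 'f::field) \<Rightarrow> (nat \<Rightarrow> 'f) \<Rightarrow> (nat \<Rightarrow> 'u, 'f) mat" where
  "zmat \<alpha> \<beta> = tens n U (\<lambda>i s t. \<alpha> i * of_bool (s = t) + \<beta> i * cl i s t)"

lemma zmat_mats: "zmat \<alpha> \<beta> \<in> mats X"
  unfolding zmat_def by (rule tens_mats)

lemma zmat_cong:
  "(\<And>i. i \<in> {1..n} \<Longrightarrow> \<alpha> i = \<alpha>' i) \<Longrightarrow> (\<And>i. i \<in> {1..n} \<Longrightarrow> \<beta> i = \<beta>' i) \<Longrightarrow> zmat \<alpha> \<beta> = zmat \<alpha>' \<beta>'"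
  unfolding zmat_def by (intro tens_cong) simp

lemma zmat_mult:
  "mmul X (zmat \<alpha> \<beta>) (zmat \<alpha>' \<beta>') =
   zmat (\<lambda>i. \<alpha> i * \<alpha>' i) (\<lambda>i. \<alpha> i * \<beta>' i + \<beta> i * \<alpha>' i + k i * \<beta> i * \<beta>' i)"
proof -
  have "(\<Sum>v\<in>U i. (\<alpha> i * of_bool (s = v) + \<beta> i * cl i s v) * (\<alpha>' i * of_bool (v = t) + \<beta>' i * cl i v t)) =
      \<alpha> i * \<alpha>' i * of_bool (s = t) + (\<alpha> i * \<beta>' i + \<beta> i * \<alpha>' i + k i * \<beta> i * \<beta>' i) * cl i s t"
    if i: "i \<in> {1..n}" and s: "s \<in> U i" and t: "t \<in> U i" for i s t
  proof -
    have "(\<Sum>v\<in>U i. (\<alpha> i * of_bool (s = v) + \<beta> i * cl i s v) * (\<alpha>' i * of_bool (v = t) + \<beta>' i * cl i v t)) =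
      (\<Sum>v\<in>U i. \<alpha> i * (of_bool (s = v) * (\<alpha>' i * of_bool (v = t) + \<beta>' i * cl i v t))
        + \<beta> i * \<alpha>' i * (cl i s v * of_bool (v = t)) + \<beta> i * \<beta>' i * (cl i s v * cl i v t))"
      by (intro sum.cong) (simp_all add: algebra_simps)
    also have "\<dots> = \<alpha> i * (\<alpha>' i * of_bool (s = t) + \<beta>' i * cl i s t)
        + \<beta> i * \<alpha>' i * cl i s t + \<beta> i * \<beta>' i * (k i * cl i s t)"
      using i s t by (simp only: sum.distrib sum_distrib_left[symmetric] sum_eq_left sum_eq_right cl_square)
    finally show ?thesis by (simp add: algebra_simps)
  qed
  then show ?thesis
    unfolding zmat_def tens_mult by (intro tens_cong) (simp add: mmul_def)
qed

lemma zmat_scale: "zmat (\<lambda>i. \<gamma> i * \<alpha> i) (\<lambda>i. \<gamma> i * \<beta> i) = msmult (\<Prod>i\<in>{1..n}. \<gamma> i) (zmat \<alpha> \<beta>)"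
proof -
  have "\<gamma> i * \<alpha> i * b + \<gamma> i * \<beta> i * c = \<gamma> i * (\<alpha> i * b + \<beta> i * c)" for i b c
    by (simp add: algebra_simps)
  then show ?thesis
    by (simp add: zmat_def tens_def msmult_def fun_eq_iff prod.distrib)
qed

lemma zmat_eq_0: "zmat \<alpha> \<beta> = 0" if "i \<in> {1..n}" "\<alpha> i = 0" "\<beta> i = 0"
  using that by (simp add: zmat_def fun_eq_iff tens_eq_0[of i])

text \<open>Multiplies out the coordinates in \<open>P\<close> only; \<open>a\<close> collects those
  where the summand with \<open>cl i\<close> is chosen. With all coordinates in \<open>P\<close>
  this yields the matrices \<open>Cmat\<close>, with the plus part it yields their products with a
  block idempotent.\<close>

lemma zmat_expand:
  assumes "P \<subseteq> {1..n}"
  shows "zmat \<alpha> \<beta> = (\<Sum>a\<in>Pow P. msmult ((\<Prod>i\<in>a. \<beta> i) * (\<Prod>i\<in>P - a. \<alpha> i))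
     (zmat (\<lambda>i. if i \<in> P then of_bool (i \<notin> a) else \<alpha> i) (\<lambda>i. if i \<in> P then of_bool (i \<in> a) else \<beta> i)))"
    (is "_ = (\<Sum>a\<in>_. msmult (?c a) (?Z a))")
proof (intro ext)
  fix y z
  show "zmat \<alpha> \<beta> y z = (\<Sum>a\<in>Pow P. msmult (?c a) (?Z a)) y z"
  proof (cases "y \<in> X \<and> z \<in> X")
    case True
    have finP: "finite P" using assms finite_subset by blast
    define e where "e i = (of_bool (y i = z i) :: 'a)" for i
    define c where "c i = (cl i (y i) (z i) :: 'a)" for i
    define R where "R = (\<Prod>i\<in>{1..n} - P. \<alpha> i * e i + \<beta> i * c i)"
    have split: "(\<Prod>i\<in>{1..n}. f i) = (\<Prod>i\<in>P. f i) * (\<Prod>i\<in>{1..n} - P. f i)" for f :: "nat \<Rightarrow> 'a"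
      using assms by (simp add: prod.subset_diff mult.commute)
    have Z: "?c a * ?Z a y z = (\<Prod>i\<in>a. \<beta> i * c i) * (\<Prod>i\<in>P - a. \<alpha> i * e i) * R" if "a \<subseteq> P" for a
    proof -
      have "?Z a y z = (\<Prod>i\<in>{1..n}. if i \<in> P then of_bool (i \<notin> a) * e i + of_bool (i \<in> a) * c i
          else \<alpha> i * e i + \<beta> i * c i)"
        using True by (auto simp: zmat_def tens_def e_def c_def intro!: prod.cong)
      also have "\<dots> = (\<Prod>i\<in>P. of_bool (i \<notin> a) * e i + of_bool (i \<in> a) * c i) * R"
        unfolding split R_def by (intro arg_cong2[of _ _ _ _ "(*)"] prod.cong) auto
      also have "(\<Prod>i\<in>P. of_bool (i \<notin> a) * e i + of_bool (i \<in> a) * c i) =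
          (\<Prod>i\<in>P - a. of_bool (i \<notin> a) * e i + of_bool (i \<in> a) * c i) *
          (\<Prod>i\<in>a. of_bool (i \<notin> a) * e i + of_bool (i \<in> a) * c i)"
        using that finP by (rule prod.subset_diff)
      also have "\<dots> = (\<Prod>i\<in>P - a. e i) * (\<Prod>i\<in>a. c i)"
        by (intro arg_cong2[of _ _ _ _ "(*)"] prod.cong) auto
      finally show ?thesis by (simp add: prod.distrib mult_ac)
    qed
    have "zmat \<alpha> \<beta> y z = (\<Prod>i\<in>{1..n}. \<alpha> i * e i + \<beta> i * c i)"
      using True by (simp add: zmat_def tens_def e_def c_def)
    also have "\<dots> = (\<Prod>i\<in>P. \<beta> i * c i + \<alpha> i * e i) * R"
      unfolding split R_def by (simp add: add.commute)
    also have "\<dots> = (\<Sum>a\<in>Pow P. (\<Prod>i\<in>a. \<beta> i * c i) * (\<Prod>i\<in>P - a. \<alpha> i * e i) * R)"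
      by (simp add: prod_add[OF finP] sum_distrib_right)
    also have "\<dots> = (\<Sum>a\<in>Pow P. ?c a * ?Z a y z)"
      using Z by (intro sum.cong) auto
    finally show ?thesis
      by (simp add: sum_mat_apply msmult_def)
  next
    case False
    then have "zmat \<alpha>' \<beta>' y z = 0" for \<alpha>' \<beta>' :: "nat \<Rightarrow> 'a"
      by (auto simp: zmat_def tens_def)
    then show ?thesis by (simp add: sum_mat_apply msmult_def)
  qed
qed

subsection \<open>The Terwilliger algebra\<close>

lemma adj_mats: "adj n U h \<in> mats X"
  by (simp add: adj_eq_tens tens_mats)

lemma dual_idem_mats: "dual_idem n U x h \<in> mats X"
  by (simp add: dual_idem_eq_tens[OF base] tens_mats)

lemma is_subalgebra_T: "is_subalgebra X T"
  unfolding terwilliger_def using adj_mats dual_idem_mats by (intro is_subalgebra_hull) auto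

lemma adj_T: "h \<subseteq> {1..n} \<Longrightarrow> adj n U h \<in> T"
  unfolding terwilliger_def by (intro hull_inc) auto

lemma dual_idem_T: "h \<subseteq> {1..n} \<Longrightarrow> dual_idem n U x h \<in> T"
  unfolding terwilliger_def by (intro hull_inc) auto

lemma T_mats: "T \<subseteq> mats X" and subspace_T: "mat.subspace T"
  and mmul_T: "A \<in> T \<Longrightarrow> B \<in> T \<Longrightarrow> mmul X A B \<in> T"
  using is_subalgebra_T by (auto simp: is_subalgebra_def)

lemma T_minimal:
  "is_subalgebra X S \<Longrightarrow> (\<And>h. h \<subseteq> {1..n} \<Longrightarrow> adj n U h \<in> S) \<Longrightarrow>
    (\<And>h. h \<subseteq> {1..n} \<Longrightarrow> dual_idem n U x h \<in> S) \<Longrightarrow> T \<subseteq> S"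
  unfolding terwilliger_def by (intro hull_minimal) auto

text \<open>The identity part of each factor commutes with anything, so only \<open>cl i\<close> has
  to be compared with \<open>M i\<close>.\<close>

lemma zmat_commute_tens:
  assumes "\<And>i s t. i \<in> {1..n} \<Longrightarrow> s \<in> U i \<Longrightarrow> t \<in> U i \<Longrightarrow>
    (\<Sum>v\<in>U i. M i s v * cl i v t) = (\<Sum>v\<in>U i. cl i s v * M i v t)"
  shows "mmul X (tens n U M) (zmat \<alpha> \<beta>) = mmul X (zmat \<alpha> \<beta>) (tens n U M)"
proof -
  have "(\<Sum>v\<in>U i. M i s v * (\<alpha> i * of_bool (v = t) + \<beta> i * cl i v t)) =
      (\<Sum>v\<in>U i. (\<alpha> i * of_bool (s = v) + \<beta> i * cl i s v) * M i v t)"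
    if i: "i \<in> {1..n}" and s: "s \<in> U i" and t: "t \<in> U i" for i s t
  proof -
    have "(\<Sum>v\<in>U i. M i s v * (\<alpha> i * of_bool (v = t) + \<beta> i * cl i v t)) =
        (\<Sum>v\<in>U i. \<alpha> i * (M i s v * of_bool (v = t)) + \<beta> i * (M i s v * cl i v t))"
      by (simp add: algebra_simps)
    also have "\<dots> = \<alpha> i * M i s t + \<beta> i * (\<Sum>v\<in>U i. cl i s v * M i v t)"
      using i s t by (simp only: sum.distrib sum_distrib_left[symmetric] sum_eq_right assms)
    also have "\<dots> = (\<Sum>v\<in>U i. \<alpha> i * (of_bool (s = v) * M i v t) + \<beta> i * (cl i s v * M i v t))"
      using i s t by (simp only: sum.distrib sum_distrib_left[symmetric] sum_eq_left)
    finally show ?thesis by (simp add: algebra_simps)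
  qed
  then show ?thesis
    unfolding zmat_def tens_mult by (intro tens_cong) (simp add: mmul_def)
qed

lemma zmat_commute_T: "A \<in> T \<Longrightarrow> mmul X A (zmat \<alpha> \<beta>) = mmul X (zmat \<alpha> \<beta>) A"
proof -
  have "T \<subseteq> {A \<in> mats X. mmul X A (zmat \<alpha> \<beta>) = mmul X (zmat \<alpha> \<beta>) A}"
    by (intro T_minimal is_subalgebra_centralizer[OF zmat_mats finite_X])
      (auto simp: adj_mats dual_idem_mats adj_eq_tens dual_idem_eq_tens[OF base] tens_mats
        intro!: zmat_commute_tens cl_comm_adj cl_comm_dual)
  then show "A \<in> T \<Longrightarrow> mmul X A (zmat \<alpha> \<beta>) = mmul X (zmat \<alpha> \<beta>) A" by blast
qed

lemma mmul_dual_idem_left: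
  "mmul X (dual_idem n U x h) A y z = of_bool ((x, y) \<in> srel n U h) * A y z"
proof -
  have "mmul X (dual_idem n U x h) A y z = (\<Sum>w\<in>X. if w = y then of_bool ((x, y) \<in> srel n U h) * A y z else 0)"
    unfolding mmul_def by (intro sum.cong) (auto simp: dual_idem_def)
  also have "\<dots> = of_bool ((x, y) \<in> srel n U h) * A y z"
    using finite_X by (auto simp: sum.delta srel_def)
  finally show ?thesis .
qed

lemma mmul_dual_idem_right:
  "mmul X A (dual_idem n U x h) y z = A y z * of_bool ((x, z) \<in> srel n U h)"
proof -
  have "mmul X A (dual_idem n U x h) y z = (\<Sum>w\<in>X. if w = z then A y z * of_bool ((x, z) \<in> srel n U h) else 0)"
    unfolding mmul_def by (intro sum.cong) (auto simp: dual_idem_def)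
  also have "\<dots> = A y z * of_bool ((x, z) \<in> srel n U h)"
    using finite_X by (auto simp: sum.delta srel_def)
  finally show ?thesis .
qed

lemma Bmat_apply:
  assumes "a \<subseteq> {1..n}" "b \<subseteq> {1..n}" "c \<subseteq> {1..n}"
  shows "Bmat n U x a b c y z =
    (of_bool (y \<in> X \<and> z \<in> X \<and> diff_set x y = a \<and> diff_set x z = c \<and> diff_set y z \<subseteq> b) :: 'f::field)"
proof -
  let ?J = "{j. sym_diff a c \<subseteq> j \<and> j \<subseteq> b}"
  have "?J \<subseteq> Pow {1..n}" using assms(2) by blast
  then have J: "finite ?J" "\<And>j. j \<in> ?J \<Longrightarrow> j \<subseteq> {1..n}"
    using finite_subset[of ?J "Pow {1..n}"] by auto
  have "Bmat n U x a b c y z = (\<Sum>j\<in>?J. of_bool ((x, y) \<in> srel n U a) * of_bool ((y, z) \<in> srel n U j) *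
      (of_bool ((x, z) \<in> srel n U c) :: 'f))"
    by (simp add: Bmat_def sum_mat_apply mmul_dual_idem_left mmul_dual_idem_right adj_def)
  also have "\<dots> = (\<Sum>j\<in>?J. if j = diff_set y z then
      of_bool (y \<in> X \<and> z \<in> X \<and> diff_set x y = a \<and> diff_set x z = c) else 0)"
    using assms J base by (intro sum.cong) (auto simp: srel_iff)
  \<comment> \<open>\<open>diff_set y z\<close> respects the lower bound on \<open>j\<close>: a
    coordinate where exactly one of \<open>y\<close>, \<open>z\<close> agrees with \<open>x\<close>
    is one where they differ.\<close>
  also have "\<dots> = of_bool (y \<in> X \<and> z \<in> X \<and> diff_set x y = a \<and> diff_set x z = c \<and> diff_set y z \<subseteq> b)"
    using J(1) by (auto simp: sum.delta diff_set_def)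
  finally show ?thesis .
qed

lemma Bmat_T: "Bmat n U x a b c \<in> T" if "a \<subseteq> {1..n}" "b \<subseteq> {1..n}" "c \<subseteq> {1..n}"
  unfolding Bmat_def using that
  by (intro mat.subspace_sum[OF subspace_T] mmul_T dual_idem_T adj_T) auto

lemma Cmat_T: "Cmat n U x a \<in> T"
  unfolding Cmat_def
  by (intro mat.subspace_sum[OF subspace_T] mat.subspace_scale[OF subspace_T] Bmat_T) auto

text \<open>At an entry \<open>(y, z)\<close> only \<open>j = diff_set x y\<close> contributes. On
  \<open>a - j\<close> both points agree with \<open>x\<close>, each \<open>cl i\<close> has entry
  \<open>k i\<close>, and \<open>kval U (a - j)\<close> is the product of these entries.\<close>

lemma Cmat_eq_zmat:
  assumes "a \<subseteq> {1..n}"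
  shows "Cmat n U x a = (zmat (\<lambda>i. of_bool (i \<notin> a)) (\<lambda>i. of_bool (i \<in> a)) :: (nat \<Rightarrow> 'u, 'f::field) mat)"
proof (intro ext)
  fix y z
  show "Cmat n U x a y z = (zmat (\<lambda>i. of_bool (i \<notin> a)) (\<lambda>i. of_bool (i \<in> a)) y z :: 'f)"
  proof (cases "y \<in> X \<and> z \<in> X")
    case True
    let ?d = "diff_set x y"
    have d: "?d \<subseteq> {1..n}" by (auto simp: diff_set_def)
    have "Cmat n U x a y z = (\<Sum>j\<in>Pow {1..n}. if j = ?d then
        of_nat (kval U (a - ?d)) * of_bool (diff_set x z = ?d \<and> diff_set y z \<subseteq> a) else (0 :: 'f))"
      unfolding Cmat_def sum_mat_apply msmult_def
    proof (intro sum.cong refl)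
      fix j assume "j \<in> Pow {1..n}"
      then show "of_nat (kval U (a - j)) * Bmat n U x j (a \<inter> j) j y z =
        (if j = ?d then of_nat (kval U (a - ?d)) * of_bool (diff_set x z = ?d \<and> diff_set y z \<subseteq> a) else (0 :: 'f))"
        using True by (subst Bmat_apply) (auto simp: diff_set_def)
    qed
    also have "\<dots> = of_nat (kval U (a - ?d)) * of_bool (diff_set x z = ?d \<and> diff_set y z \<subseteq> a)"
      using d by (simp add: sum.delta)
    also have "\<dots> = zmat (\<lambda>i. of_bool (i \<notin> a)) (\<lambda>i. of_bool (i \<in> a)) y z"
    proof (cases "diff_set x z = ?d \<and> diff_set y z \<subseteq> a")
      case same: True
      have i: "i \<in> ?d \<longleftrightarrow> x i \<noteq> y i" "x i = z i \<longleftrightarrow> x i = y i" "y i \<noteq> z i \<Longrightarrow> i \<in> a" if "i \<in> {1..n}" for i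
        using that same unfolding diff_set_eq_iff diff_set_subset_iff by (auto simp: diff_set_def)
      have "of_bool (i \<notin> a) * of_bool (y i = z i) + of_bool (i \<in> a) * cl i (y i) (z i) =
          (if i \<in> a - ?d then k i else (1 :: 'f))" if "i \<in> {1..n}" for i
      proof (cases "y i = x i")
        case True
        then show ?thesis using i(1,2)[OF that] by (simp add: cl_def)
      next
        case False
        then show ?thesis using i[OF that] by (auto simp: cl_def)
      qed
      then have "zmat (\<lambda>i. of_bool (i \<notin> a)) (\<lambda>i. of_bool (i \<in> a)) y z =
          (\<Prod>i\<in>{1..n}. if i \<in> a - ?d then k i else (1 :: 'f))"
        using True unfolding zmat_def tens_def by (auto intro!: prod.cong)
      also have "\<dots> = of_nat (kval U (a - ?d))"
        using assms by (subst prod.inter_restrict[symmetric]) (auto simp: kval_def intro!: prod.cong)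
      finally show ?thesis using same by simp
    next
      case False
      then have "\<exists>i\<in>{1..n}. (x i = z i) \<noteq> (x i = y i) \<or> y i \<noteq> z i \<and> i \<notin> a"
        unfolding diff_set_eq_iff diff_set_subset_iff by blast
      then obtain i where i: "i \<in> {1..n}" "(x i = z i) \<noteq> (x i = y i) \<or> y i \<noteq> z i \<and> i \<notin> a"
        by blast
      \<comment> \<open>Either exactly one point is at the base, where the identity and
        \<open>cl i\<close> both vanish, or the points differ at a coordinate that carries the
        identity.\<close>
      then have "of_bool (i \<notin> a) * of_bool (y i = z i) + of_bool (i \<in> a) * cl i (y i) (z i) = (0 :: 'f)"
        unfolding cl_def by (cases "y i = x i"; cases "z i = x i") (simp_all add: eq_commute[of "x i"])
      with i(1) have "zmat (\<lambda>i. of_bool (i \<notin> a)) (\<lambda>i. of_bool (i \<in> a)) y z = (0 :: 'f)"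
        unfolding zmat_def by (intro tens_eq_0)
      then show ?thesis using False by simp
    qed
    finally show ?thesis .
  next
    case False
    have "Bmat n U x j (a \<inter> j) j y z = (0 :: 'f)" if "j \<in> Pow {1..n}" for j
      using that False by (subst Bmat_apply) auto
    then have "Cmat n U x a y z = (0 :: 'f)"
      by (simp add: Cmat_def sum_mat_apply msmult_def)
    moreover have "zmat \<alpha> \<beta> y z = 0" for \<alpha> \<beta> :: "nat \<Rightarrow> 'f"
      using False by (auto simp: zmat_def tens_def)
    ultimately show ?thesis by simp
  qed
qed

lemma zmat_T: "zmat \<alpha> \<beta> \<in> T"
proof -
  have "zmat (\<lambda>i. if i \<in> {1..n} then of_bool (i \<notin> a) else \<alpha> i)
      (\<lambda>i. if i \<in> {1..n} then of_bool (i \<in> a) else \<beta> i) = Cmat n U x a" if "a \<subseteq> {1..n}" for a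
    unfolding Cmat_eq_zmat[OF that] by (rule zmat_cong) auto
  then show ?thesis
    unfolding zmat_expand[OF order_refl, of \<alpha> \<beta>]
    by (intro mat.subspace_sum[OF subspace_T] mat.subspace_scale[OF subspace_T]) (auto simp: Cmat_T)
qed


lemma mem_diff_set_iff: "i \<in> diff_set y z \<longleftrightarrow> i \<in> {1..n} \<and> y i \<noteq> z i"
  by (simp add: diff_set_def)

lemma finite_index: "a \<subseteq> {1..n} \<Longrightarrow> finite a"
  by (rule finite_subset[OF _ finite_atLeastAtMost])

subsection \<open>The block idempotents\<close>

lemma k_eq_0_iff: "(k i :: 'f::field) = 0 \<longleftrightarrow> CHAR('f) dvd card (U i) - 1"
  by (rule of_nat_eq_0_iff_char_dvd)

lemma plus_part_iff: "i \<in> plus_part CHAR('f::field) U V \<longleftrightarrow> i \<in> V \<and> (k i :: 'f) = 0"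
  by (simp only: plus_part_def k_eq_0_iff mem_Collect_eq)

lemma minus_part_iff:
  "i \<in> minus_part CHAR('f::field) U V \<longleftrightarrow> i \<in> V \<and> card (U i) \<noteq> 2 \<and> (k i :: 'f) \<noteq> 0"
  by (simp only: minus_part_def k_eq_0_iff mem_Collect_eq)

lemma of_nat_kval: "of_nat (kval U q) = (\<Prod>i\<in>q. k i :: 'f::field)"
  by (simp add: kval_def)

lemma char_dvd_kval_iff:
  "finite q \<Longrightarrow> CHAR('f::field) dvd kval U q \<longleftrightarrow> (\<exists>i\<in>q. (k i :: 'f) = 0)"
  by (simp only: of_nat_eq_0_iff_char_dvd[symmetric] of_nat_kval prod_zero_iff)

text \<open>A product in a field vanishes only with one of its factors, so the divisibility
  condition on \<open>kval U q\<close> is a condition on each element of \<open>q\<close>. This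
  turns the index sets of \<open>Dmat\<close> and of the classes into ranges of subsets.\<close>

lemma subset_minus_part_iff:
  "finite q \<Longrightarrow> q \<subseteq> minus_part CHAR('f::field) U V \<longleftrightarrow> q \<subseteq> circ_part U V \<and> \<not> CHAR('f) dvd kval U q"
  unfolding char_dvd_kval_iff subset_iff minus_part_iff circ_part_def by blast

lemma minus_part_eq_Int: "V \<subseteq> W \<Longrightarrow> minus_part p U V = V \<inter> minus_part p U W"
  unfolding minus_part_def by blast

text \<open>A class is recorded by the common value \<open>s\<close> of the differences
  \<open>minus_part p U a - b\<close>: the coordinates in \<open>s\<close> carry
  \<open>1 - cl / k\<close>, the other minus coordinates \<open>cl / k\<close>.\<close>

definition blk_al :: "nat set \<Rightarrow> nat \<Rightarrow> 'f::field" where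
  "blk_al s i = (if i \<in> minus_part CHAR('f) U {1..n} - s then 0 else 1)"

definition blk_be :: "nat set \<Rightarrow> nat \<Rightarrow> 'f::field" where
  "blk_be s i = (if i \<in> s then - inverse (k i)
     else if i \<in> minus_part CHAR('f) U {1..n} then inverse (k i) else 0)"

abbreviation blk :: "nat set \<Rightarrow> (nat \<Rightarrow> 'u, 'f::field) mat" where
  "blk s \<equiv> zmat (blk_al s) (blk_be s)"

text \<open>\<open>a\<close> and \<open>s\<close> force the middle index \<open>b\<close>. The sum
  in \<open>Dmat\<close> then runs over \<open>q = b \<union> r\<close> with
  \<open>r \<subseteq> s\<close>, and the sign is absorbed into the inverses over
  \<open>r\<close>.\<close>

lemma Dmat_apply:
  fixes y z :: "nat \<Rightarrow> 'u" and a s :: "nat set"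
  defines "b \<equiv> a \<inter> minus_part CHAR('f::field) U {1..n} - s"
  assumes "a \<subseteq> {1..n}" "s \<subseteq> a" "s \<subseteq> minus_part CHAR('f) U {1..n}"
  shows "Dmat n U x a b a y z = of_bool (y \<in> X \<and> z \<in> X \<and> diff_set x y = a \<and> diff_set x z = a) *
    (\<Sum>r\<in>Pow s. (\<Prod>i\<in>r. - inverse (k i)) * (\<Prod>i\<in>b. inverse (k i)) * (of_bool (diff_set y z \<subseteq> b \<union> r) :: 'f))"
proof -
  have fin': "finite b" "finite s"
    using assms(2,3) by (auto simp: b_def intro!: finite_index)
  have disj: "b \<inter> s = {}" by (auto simp: b_def)
  have ba: "b \<subseteq> a" and minus: "a \<inter> minus_part CHAR('f) U {1..n} = b \<union> s"
    using assms(3,4) unfolding b_def by blast+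
  have Q: "{q \<in> Pow {1..n}. b \<subseteq> q \<and> q \<subseteq> sym_diff a a \<union> circ_part U (a \<inter> a) \<and> \<not> CHAR('f) dvd kval U q}
      = (\<lambda>r. b \<union> r) ` Pow s" (is "?Q = _")
  proof -
    have "?Q = {q. b \<subseteq> q \<and> q \<subseteq> b \<union> s}"
    proof (rule set_eqI)
      fix q
      have "q \<in> ?Q \<longleftrightarrow> q \<in> Pow {1..n} \<and> b \<subseteq> q \<and> q \<subseteq> circ_part U a \<and> \<not> CHAR('f) dvd kval U q"
        by (simp only: mem_Collect_eq Diff_cancel Un_empty_left Int_absorb)
      also have "\<dots> \<longleftrightarrow> q \<in> Pow {1..n} \<and> b \<subseteq> q \<and> q \<subseteq> minus_part CHAR('f) U a"
        using subset_minus_part_iff[of q, where 'f = 'f] finite_subset[of q "{1..n}"] by auto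
      also have "\<dots> \<longleftrightarrow> q \<in> {q. b \<subseteq> q \<and> q \<subseteq> b \<union> s}"
        using minus_part_eq_Int[OF assms(2), of "CHAR('f)"] minus assms(2) by auto
      finally show "q \<in> ?Q \<longleftrightarrow> q \<in> {q. b \<subseteq> q \<and> q \<subseteq> b \<union> s}" .
    qed
    also have "\<dots> = (\<lambda>r. b \<union> r) ` Pow s"
    proof (intro equalityI subsetI)
      fix q assume "q \<in> {q. b \<subseteq> q \<and> q \<subseteq> b \<union> s}"
      then have "q = b \<union> (q - b)" "q - b \<in> Pow s" by auto
      then show "q \<in> (\<lambda>r. b \<union> r) ` Pow s" by (rule image_eqI)
    qed auto
    finally show ?thesis .
  qed
  have inj: "inj_on (\<lambda>r. b \<union> r) (Pow s)"
    using disj by (intro inj_onI) blast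
  have trm: "(- 1) ^ card (b \<union> r - b) * inverse (of_nat (kval U (a \<inter> (b \<union> r)))) * Bmat n U x a (b \<union> r) a y z =
      of_bool (y \<in> X \<and> z \<in> X \<and> diff_set x y = a \<and> diff_set x z = a) *
      ((\<Prod>i\<in>r. - inverse (k i)) * (\<Prod>i\<in>b. inverse (k i)) * (of_bool (diff_set y z \<subseteq> b \<union> r) :: 'f))"
    if r: "r \<in> Pow s" for r
  proof -
    have "b \<union> r - b = r" "a \<inter> (b \<union> r) = b \<union> r" "finite r" "b \<inter> r = {}" "b \<union> r \<subseteq> {1..n}"
      using r disj ba assms(2,3) finite_subset[OF _ fin'(2), of r] by auto
    moreover have "(\<Prod>i\<in>r. - inverse (k i)) = (- 1) ^ card r * (\<Prod>i\<in>r. inverse (k i) :: 'f)"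
      using prod.distrib[of "\<lambda>_. - 1" "\<lambda>i. inverse (k i) :: 'f" r] by simp
    ultimately show ?thesis
      using assms(2) fin' by (simp add: Bmat_apply of_nat_kval prod.union_disjoint prod_inversef[symmetric] del: of_nat_diff)
  qed
  show ?thesis
    unfolding Dmat_def sum_mat_apply msmult_def Q sum.reindex[OF inj] comp_def sum_distrib_left
    using trm by (intro sum.cong refl)
qed

text \<open>The right side is the sum found for \<open>Dmat\<close>; here it comes from multiplying
  out, over \<open>s\<close>, the identity entry minus \<open>inverse (k i)\<close>.\<close>

lemma blk_apply:
  fixes y z :: "nat \<Rightarrow> 'u" and a s :: "nat set"
  defines "b \<equiv> a \<inter> minus_part CHAR('f::field) U {1..n} - s"
  assumes yz: "y \<in> X" "z \<in> X" "diff_set x y = a" "diff_set x z = a"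
    and s: "s \<subseteq> a" "s \<subseteq> minus_part CHAR('f) U {1..n}"
  shows "blk s y z =
    (\<Sum>r\<in>Pow s. (\<Prod>i\<in>r. - inverse (k i)) * (\<Prod>i\<in>b. inverse (k i)) * (of_bool (diff_set y z \<subseteq> b \<union> r) :: 'f))"
proof -
  have a: "a \<subseteq> {1..n}" using yz(3) diff_set_subset by blast
  have ba: "b \<subseteq> {1..n}" "b \<inter> s = {}" using a by (auto simp: b_def)
  have fs: "finite s" using s(1) a by (intro finite_index) auto
  define e where "e i = (of_bool (y i = z i) :: 'f)" for i
  define c where "c i = (cl i (y i) (z i) :: 'f)" for i
  have in_a: "y i \<noteq> x i" "z i \<noteq> x i" if "i \<in> a" for i
    using that yz(3,4) mem_diff_set_iff[of i x y] mem_diff_set_iff[of i x z] by auto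
  have out_a: "y i = x i" "z i = x i" if "i \<in> {1..n}" "i \<notin> a" for i
    using that yz(3,4) mem_diff_set_iff[of i x y] mem_diff_set_iff[of i x z] by auto
  have L1: "blk_al s i * e i + blk_be s i * c i = - inverse (k i) + e i" if "i \<in> s" for i
    using that s(1) in_a[of i] by (auto simp: blk_al_def blk_be_def c_def cl_def)
  have L2: "blk_al s i * e i + blk_be s i * c i = inverse (k i)" if "i \<in> b" for i
    using that in_a[of i] by (auto simp: blk_al_def blk_be_def c_def cl_def b_def)
  \<comment> \<open>At a minus coordinate outside \<open>a\<close> both points are at the base,
    where the entry \<open>k i\<close> of \<open>cl i\<close> cancels
    \<open>inverse (k i)\<close>.\<close>
  have L3: "blk_al s i * e i + blk_be s i * c i = e i" if "i \<in> {1..n} - (s \<union> b)" for i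
  proof (cases "i \<in> a")
    case True
    then have "i \<notin> minus_part CHAR('f) U {1..n}" "i \<notin> s" using that by (auto simp: b_def)
    then show ?thesis by (simp add: blk_al_def blk_be_def)
  next
    case False
    then have "e i = 1" "c i = k i" "i \<notin> s"
      using out_a[of i] that by (auto simp: e_def c_def cl_def)
    moreover have "k i \<noteq> (0 :: 'f)" if "i \<in> minus_part CHAR('f) U {1..n}"
      using that unfolding minus_part_iff by blast
    ultimately show ?thesis
      by (auto simp: blk_al_def blk_be_def simp del: of_nat_diff)
  qed
  have "blk s y z = (\<Prod>i\<in>{1..n}. blk_al s i * e i + blk_be s i * c i)"
    using yz by (simp add: zmat_def tens_def e_def c_def)
  also have "\<dots> = (\<Prod>i\<in>{1..n} - (s \<union> b). blk_al s i * e i + blk_be s i * c i) *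
      (\<Prod>i\<in>s \<union> b. blk_al s i * e i + blk_be s i * c i)"
    using s a ba by (intro prod.subset_diff) auto
  also have "(\<Prod>i\<in>s \<union> b. blk_al s i * e i + blk_be s i * c i) =
      (\<Prod>i\<in>s. blk_al s i * e i + blk_be s i * c i) * (\<Prod>i\<in>b. blk_al s i * e i + blk_be s i * c i)"
    using fs ba finite_index[of b] by (intro prod.union_disjoint) auto
  also have "\<dots> = (\<Prod>i\<in>s. - inverse (k i) + e i) * (\<Prod>i\<in>b. inverse (k i))"
    using L1 L2 by (intro arg_cong2[of _ _ _ _ "(*)"] prod.cong) auto
  also have "(\<Prod>i\<in>{1..n} - (s \<union> b). blk_al s i * e i + blk_be s i * c i) = (\<Prod>i\<in>{1..n} - (s \<union> b). e i)"
    using L3 by (intro prod.cong) auto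
  finally have "blk s y z = (\<Sum>r\<in>Pow s. (\<Prod>i\<in>{1..n} - (s \<union> b). e i) *
      ((\<Prod>i\<in>r. - inverse (k i)) * (\<Prod>i\<in>s - r. e i) * (\<Prod>i\<in>b. inverse (k i))))"
    unfolding prod_add[OF fs] sum_distrib_left sum_distrib_right .
  also have "\<dots> = (\<Sum>r\<in>Pow s. (\<Prod>i\<in>r. - inverse (k i)) * (\<Prod>i\<in>b. inverse (k i)) * (of_bool (diff_set y z \<subseteq> b \<union> r) :: 'f))"
  proof (intro sum.cong refl)
    fix r assume r: "r \<in> Pow s"
    have "(\<Prod>i\<in>{1..n} - (s \<union> b). e i) * (\<Prod>i\<in>s - r. e i) = (\<Prod>i\<in>({1..n} - (s \<union> b)) \<union> (s - r). e i)"
      using fs by (intro prod.union_disjoint[symmetric]) auto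
    also have "({1..n} - (s \<union> b)) \<union> (s - r) = {1..n} - (b \<union> r)"
      using r s a ba by blast
    also have "(\<Prod>i\<in>{1..n} - (b \<union> r). e i) = of_bool (diff_set y z \<subseteq> b \<union> r)"
      unfolding e_def by (subst prod_of_bool) (auto simp: diff_set_def)
    finally show "(\<Prod>i\<in>{1..n} - (s \<union> b). e i) * ((\<Prod>i\<in>r. - inverse (k i)) * (\<Prod>i\<in>s - r. e i) * (\<Prod>i\<in>b. inverse (k i)))
        = (\<Prod>i\<in>r. - inverse (k i)) * (\<Prod>i\<in>b. inverse (k i)) * (of_bool (diff_set y z \<subseteq> b \<union> r) :: 'f)"
      by (metis (no_types, lifting) mult.assoc mult.commute)
  qed
  finally show ?thesis .
qed

text \<open>Every factor respects the splitting into base and other points. At a coordinate of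
  \<open>s\<close> where both points are at the base, the factor \<open>1 - cl / k\<close> has entry
  \<open>1 - k / k = 0\<close>.\<close>

lemma blk_apply_0:
  assumes "\<not> (y \<in> X \<and> z \<in> X \<and> diff_set x z = diff_set x y \<and> s \<subseteq> diff_set x y)"
    and s: "s \<subseteq> minus_part CHAR('f) U {1..n}"
  shows "blk s y z = (0 :: 'f::field)"
proof (cases "y \<in> X \<and> z \<in> X")
  case True
  show ?thesis
  proof (cases "diff_set x z = diff_set x y")
    case same: True
    then obtain i where i: "i \<in> s" "i \<notin> diff_set x y" "i \<notin> diff_set x z"
      using assms(1) True by auto
    then have "i \<in> {1..n}" "(k i :: 'f) \<noteq> 0"
      using s minus_part_iff[of i, where 'f = 'f] by blast+
    moreover from this i have "y i = x i" "z i = x i"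
      by (auto simp: diff_set_def)
    ultimately show ?thesis
      unfolding zmat_def using i(1)
      by (intro tens_eq_0[of i]) (auto simp: blk_al_def blk_be_def cl_def simp del: of_nat_diff)
  next
    case False
    then obtain i where "i \<in> {1..n}" "(x i = z i) \<noteq> (x i = y i)"
      unfolding diff_set_eq_iff by blast
    then show ?thesis
      unfolding zmat_def cl_def
      by (intro tens_eq_0[of i]) (cases "y i = x i"; cases "z i = x i"; simp add: eq_commute[of "x i"])+
  qed
next
  case False
  then show ?thesis by (auto simp: zmat_def tens_def)
qed

text \<open>The class has one triple for each \<open>a\<close> containing \<open>s\<close>, and its
  summand lives on the points \<open>y\<close> with \<open>diff_set x y = a\<close>; so at each
  entry at most one summand is nonzero.\<close>

lemma block_idem_eq_blk:
  assumes s: "s \<subseteq> minus_part CHAR('f::field) U {1..n}"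
  shows "block_idem n U x {t \<in> dtriples CHAR('f) n U. (case t of (a, b, c) \<Rightarrow> minus_part CHAR('f) U a - b) = s}
    = (blk s :: (nat \<Rightarrow> 'u, 'f) mat)"
proof -
  let ?S = "{t \<in> dtriples CHAR('f) n U. (case t of (a, b, c) \<Rightarrow> minus_part CHAR('f) U a - b) = s}"
  let ?M = "minus_part CHAR('f) U {1..n}"
  let ?A = "{a \<in> Pow {1..n}. s \<subseteq> a}"
  let ?t = "\<lambda>a. (a, a \<inter> ?M - s, a)"
  note minus = minus_part_eq_Int[of _ "{1..n}" "CHAR('f)"]
  have "?S = ?t ` ?A"
  proof (intro equalityI subsetI)
    fix t assume t: "t \<in> ?S"
    obtain a b c where abc: "t = (a, b, c)" by (cases t)
    with t have a: "a \<subseteq> {1..n}" "c = a" and b: "b \<subseteq> circ_part U a" "\<not> CHAR('f) dvd kval U b"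
      and eq: "minus_part CHAR('f) U a - b = s"
      by (auto simp: dtriples_def ptriples_def)
    have "b \<subseteq> a" using b by (auto simp: circ_part_def)
    then have "finite b" using a(1) finite_subset[of b "{1..n}"] by auto
    then have "b \<subseteq> a \<inter> ?M"
      using b subset_minus_part_iff[of b a, where 'f = 'f] minus[OF a(1)] by simp
    with eq minus[OF a(1)] have "b = a \<inter> ?M - s" "s \<subseteq> a" by auto
    then show "t \<in> ?t ` ?A"
      using abc a by auto
  next
    fix t assume "t \<in> ?t ` ?A"
    then obtain a where a: "a \<subseteq> {1..n}" "s \<subseteq> a" and t: "t = ?t a" by auto
    have "finite (a \<inter> ?M - s)" "a \<inter> ?M - s \<subseteq> minus_part CHAR('f) U a"
      using a finite_subset[of a "{1..n}"] minus[OF a(1)] by auto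
    then have "a \<inter> ?M - s \<subseteq> circ_part U a" "\<not> CHAR('f) dvd kval U (a \<inter> ?M - s)"
      using subset_minus_part_iff[of "a \<inter> ?M - s" a, where 'f = 'f] by simp_all
    moreover have "a \<inter> ?M - (a \<inter> ?M - s) = s"
      using a s by blast
    ultimately show "t \<in> ?S"
      using a t minus[OF a(1)] by (simp add: dtriples_def ptriples_def) blast
  qed
  moreover have "inj_on ?t ?A"
    by (intro inj_onI) simp
  ultimately have sum: "block_idem n U x ?S = (\<Sum>a\<in>?A. Dmat n U x a (a \<inter> ?M - s) a :: (nat \<Rightarrow> 'u, 'f) mat)"
    unfolding block_idem_def by (simp only: sum.reindex comp_def case_prod_conv)
  show ?thesis
  proof (intro ext)
    fix y z
    let ?ok = "y \<in> X \<and> z \<in> X \<and> diff_set x z = diff_set x y \<and> s \<subseteq> diff_set x y"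
    have "block_idem n U x ?S y z = (\<Sum>a\<in>?A. if a = diff_set x y then blk s y z else (0 :: 'f))"
      unfolding sum sum_mat_apply
    proof (intro sum.cong refl)
      fix a assume "a \<in> ?A"
      then have a: "a \<subseteq> {1..n}" "s \<subseteq> a" by auto
      show "Dmat n U x a (a \<inter> ?M - s) a y z = (if a = diff_set x y then blk s y z else (0 :: 'f))"
      proof (cases "y \<in> X \<and> z \<in> X \<and> diff_set x y = a \<and> diff_set x z = a")
        case True
        then show ?thesis
          unfolding Dmat_apply[OF a s] using blk_apply[of y z a s, OF _ _ _ _ a(2) s] by simp
      next
        case False
        then have "a = diff_set x y \<Longrightarrow> blk s y z = (0 :: 'f)"
          by (intro blk_apply_0[OF _ s]) auto
        then show ?thesis
          unfolding Dmat_apply[OF a s] using False by auto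
      qed
    qed
    also have "\<dots> = (if diff_set x y \<in> ?A then blk s y z else 0)"
      by (simp add: sum.delta)
    also have "\<dots> = blk s y z"
      using blk_apply_0[OF _ s, of y z] diff_set_subset[of x y] by auto
    finally show "block_idem n U x ?S y z = (blk s y z :: 'f)" .
  qed
qed


subsection \<open>Invariance under the stabilizer of the base point\<close>

definition act :: "(nat \<Rightarrow> 'u \<Rightarrow> 'u) \<Rightarrow> (nat \<Rightarrow> 'u) \<Rightarrow> nat \<Rightarrow> 'u" where
  "act \<sigma> y = (\<lambda>i\<in>{1..n}. \<sigma> i (y i))"

text \<open>The invariant matrices form a subalgebra, because the sum in a product can be reindexed
  by the bijection of \<open>X\<close>. The generators are invariant, being defined from
  \<open>x\<close> and equality of coordinates alone.\<close>

lemma T_invariant: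
  assumes A: "A \<in> T"
    and bij: "\<And>i. i \<in> {1..n} \<Longrightarrow> bij_betw (\<sigma> i) (U i) (U i)"
    and fix_base: "\<And>i. i \<in> {1..n} \<Longrightarrow> \<sigma> i (x i) = x i"
    and yz: "y \<in> X" "z \<in> X"
  shows "A (act \<sigma> y) (act \<sigma> z) = (A y z :: 'f::field)"
proof -
  have act_X: "act \<sigma> y \<in> X" if "y \<in> X" for y
    unfolding points_def act_def restrict_PiE_iff
    using bij_betwE[OF bij] points_mem[OF that] by blast
  have act_eq: "\<sigma> i (y i) = \<sigma> i (z i) \<longleftrightarrow> y i = z i" if "y \<in> X" "z \<in> X" "i \<in> {1..n}" for y z i
    using bij_betw_imp_inj_on[OF bij[OF that(3)]] points_mem[OF that(1,3)] points_mem[OF that(2,3)]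
    by (simp add: inj_on_eq_iff)
  have act_apply: "act \<sigma> y i = \<sigma> i (y i)" if "i \<in> {1..n}" for y i
    using that by (simp add: act_def)
  have act_inj: "act \<sigma> y = act \<sigma> z \<longleftrightarrow> y = z" if "y \<in> X" "z \<in> X" for y z
    using that points_eq_iff[OF act_X act_X] points_eq_iff[of y n U z] act_eq act_apply by simp
  have act_srel: "(act \<sigma> y, act \<sigma> z) \<in> srel n U h \<longleftrightarrow> (y, z) \<in> srel n U h" if "y \<in> X" "z \<in> X" for y z h
    using that act_X act_eq act_apply by (simp add: srel_def)
  have act_base: "act \<sigma> x = x"
    using points_eq_iff[OF act_X[OF base] base] fix_base act_apply by simp
  have "inj_on (act \<sigma>) X"
    using act_inj by (intro inj_onI) blast
  moreover have "act \<sigma> ` X \<subseteq> X"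
    using act_X by blast
  ultimately have act_bij: "bij_betw (act \<sigma>) X X"
    using finite_X by (simp add: bij_betw_def endo_inj_surj)
  let ?S = "{A \<in> mats X. \<forall>y\<in>X. \<forall>z\<in>X. A (act \<sigma> y) (act \<sigma> z) = (A y z :: 'f)}"
  have "is_subalgebra X ?S"
    unfolding is_subalgebra_def
  proof (intro conjI ballI)
    have "mat.subspace (mats X :: (nat \<Rightarrow> 'u, 'f) mat set)"
      by (rule subspace_mats)
    then show "mat.subspace ?S"
      by (simp add: mat.subspace_def msmult_def)
    have "mone X \<in> (mats X :: (nat \<Rightarrow> 'u, 'f) mat set)"
      by (simp add: mone_def mats_def)
    then show "mone X \<in> ?S"
      using act_inj act_X by (simp add: mone_def)
    fix A B assume A: "A \<in> ?S" and B: "B \<in> ?S"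
    have "mmul X A B (act \<sigma> y) (act \<sigma> z) = mmul X A B y z" if "y \<in> X" "z \<in> X" for y z
    proof -
      have "mmul X A B (act \<sigma> y) (act \<sigma> z) = (\<Sum>w\<in>X. A (act \<sigma> y) (act \<sigma> w) * B (act \<sigma> w) (act \<sigma> z))"
        unfolding mmul_def by (rule sum.reindex_bij_betw[OF act_bij, symmetric])
      also have "\<dots> = mmul X A B y z"
        using A B that by (simp add: mmul_def)
      finally show ?thesis .
    qed
    then show "mmul X A B \<in> ?S"
      using A B mmul_mats by blast
  qed auto
  then have "T \<subseteq> ?S"
  proof (rule T_minimal)
    fix h :: "nat set"
    show "adj n U h \<in> ?S"
      using act_srel by (simp add: adj_mats) (simp add: adj_def)
    have "(x, act \<sigma> y) \<in> srel n U h \<longleftrightarrow> (x, y) \<in> srel n U h" if "y \<in> X" for y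
      using act_srel[OF base that] act_base by simp
    then show "dual_idem n U x h \<in> ?S"
      using act_inj by (simp add: dual_idem_mats) (simp add: dual_idem_def)
  qed
  with A yz show ?thesis by blast
qed

lemma T_generic_entry:
  assumes A: "A \<in> T"
    and X: "y \<in> X" "z \<in> X" "y' \<in> X" "z' \<in> X"
    and full: "diff_set x y = {1..n}" "diff_set x z = {1..n}" "diff_set x y' = {1..n}" "diff_set x z' = {1..n}"
    and eq: "diff_set y z = diff_set y' z'"
  shows "A y z = (A y' z' :: 'f::field)"
proof -
  have "\<exists>\<sigma>. bij_betw \<sigma> (U i) (U i) \<and> \<sigma> (x i) = x i \<and> \<sigma> (y i) = y' i \<and> \<sigma> (z i) = z' i"
    if i: "i \<in> {1..n}" for i
  proof (rule exists_bij_two_points)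
    show "y i = z i \<longleftrightarrow> y' i = z' i"
      using eq i unfolding diff_set_eq_iff by blast
    have "i \<in> diff_set x y" "i \<in> diff_set x z" "i \<in> diff_set x y'" "i \<in> diff_set x z'"
      using i by (simp_all only: full)
    then show "y i \<noteq> x i" "z i \<noteq> x i" "y' i \<noteq> x i" "z' i \<noteq> x i"
      unfolding mem_diff_set_iff by simp_all metis+
  qed (use X i points_mem in auto)
  then have "\<forall>i\<in>{1..n}. \<exists>\<sigma>. bij_betw \<sigma> (U i) (U i) \<and> \<sigma> (x i) = x i \<and> \<sigma> (y i) = y' i \<and> \<sigma> (z i) = z' i"
    by (rule ballI)
  from bchoice[OF this] obtain \<sigma> where "\<forall>i\<in>{1..n}. bij_betw (\<sigma> i) (U i) (U i) \<and> \<sigma> i (x i) = x i \<and>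
      \<sigma> i (y i) = y' i \<and> \<sigma> i (z i) = z' i" ..
  then have \<sigma>: "\<And>i. i \<in> {1..n} \<Longrightarrow> bij_betw (\<sigma> i) (U i) (U i)"
      "\<And>i. i \<in> {1..n} \<Longrightarrow> \<sigma> i (x i) = x i"
      "\<And>i. i \<in> {1..n} \<Longrightarrow> \<sigma> i (y i) = y' i" "\<And>i. i \<in> {1..n} \<Longrightarrow> \<sigma> i (z i) = z' i"
    by simp_all
  have "act \<sigma> y = y'" "act \<sigma> z = z'"
    using X \<sigma>(3,4) unfolding act_def points_def by (auto intro!: PiE_ext[of _ "{1..n}" U])
  then show ?thesis
    using T_invariant[OF A \<sigma>(1,2) X(1,2)] by simp
qed

lemma T_generic_entries:
  assumes A: "A \<in> T"
  shows "\<exists>\<zeta> :: nat set \<Rightarrow> 'f::field. \<forall>y\<in>X. \<forall>z\<in>X. diff_set x y = {1..n} \<longrightarrow> diff_set x z = {1..n} \<longrightarrow>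
    A y z = \<zeta> (diff_set y z)"
proof -
  define G where "G S p \<longleftrightarrow> fst p \<in> X \<and> snd p \<in> X \<and> diff_set x (fst p) = {1..n} \<and>
    diff_set x (snd p) = {1..n} \<and> diff_set (fst p) (snd p) = S" for S p
  \<comment> \<open>At a set that is no difference of generic points the value is arbitrary; the
    equation below concerns only the others.\<close>
  define \<zeta> where "\<zeta> S = (let p = SOME p. G S p in A (fst p) (snd p))" for S
  have "A y z = \<zeta> (diff_set y z)"
    if "y \<in> X" "z \<in> X" "diff_set x y = {1..n}" "diff_set x z = {1..n}" for y z
  proof -
    have "G (diff_set y z) (y, z)" using that by (simp add: G_def)
    then have "G (diff_set y z) (SOME p. G (diff_set y z) p)" by (rule someI)
    moreover define p where "p = (SOME p. G (diff_set y z) p)"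
    ultimately have "G (diff_set y z) p" by simp
    then have "A y z = A (fst p) (snd p)"
      unfolding G_def using that by (intro T_generic_entry[OF A]) simp_all
    then show ?thesis
      by (simp only: \<zeta>_def Let_def p_def)
  qed
  then show ?thesis by blast
qed

subsection \<open>The center of the Terwilliger algebra\<close>

text \<open>Comparing \<open>J B\<close> and \<open>B J\<close> in one coordinate expresses an entry of \<open>B\<close> through
  entries whose row agrees with \<open>x\<close> in fewer coordinates.\<close>

lemma central_eq_0:
  fixes B :: "(nat \<Rightarrow> 'u, 'f::field) mat"
  assumes B: "B \<in> mats X" and comm: "\<And>A. A \<in> T \<Longrightarrow> mmul X A B = mmul X B A"
    and zero: "\<And>y z. y \<in> X \<Longrightarrow> z \<in> X \<Longrightarrow> diff_set x y = {1..n} \<Longrightarrow> diff_set x z = {1..n} \<Longrightarrow> B y z = 0"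
  shows "B = 0"
proof -
  \<comment> \<open>Commuting with the dual idempotents makes \<open>B\<close> block
    diagonal.\<close>
  have supp: "diff_set x z = diff_set x y" if "y \<in> X" "z \<in> X" "B y z \<noteq> 0" for y z
  proof -
    have "mmul X (dual_idem n U x (diff_set x y)) B y z = mmul X B (dual_idem n U x (diff_set x y)) y z"
      using comm[OF dual_idem_T[OF diff_set_subset]] by simp
    then show ?thesis
      using that base
      by (simp add: mmul_dual_idem_left mmul_dual_idem_right srel_iff[OF diff_set_subset[of x y]] of_bool_def
          split: if_splits)
  qed
  have main: "B y z = 0" if "y \<in> X" "z \<in> X" for y z
    using that
  proof (induction "card ({1..n} - diff_set x y)" arbitrary: y z rule: less_induct)
    case less
    show ?case
    proof (rule ccontr)
      assume nz: "B y z \<noteq> 0"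
      then have same: "diff_set x z = diff_set x y" using supp less.prems by blast
      then have "diff_set x y \<noteq> {1..n}" using zero less.prems nz by metis
      then obtain i where i: "i \<in> {1..n}" "i \<notin> diff_set x y" "i \<notin> diff_set x z"
        using diff_set_subset[of x y] same by blast
      then have yi: "y i = x i" and zi: "z i = x i"
        by (simp_all add: mem_diff_set_iff)
      have "card (U i - {x i}) \<noteq> 0"
        using card[OF i(1)] base_mem[OF i(1)] by simp
      then obtain t where t: "t \<in> U i" "t \<noteq> x i"
        by (metis Diff_iff card.empty ex_in_conv singletonI)
      let ?z = "z(i := t)"
      have z': "?z \<in> X"
        using less.prems(2) t(1) i(1) unfolding points_def by (auto simp: PiE_iff extensional_def)
      \<comment> \<open>A neighbour \<open>v\<close> of \<open>y\<close> along \<open>i\<close>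
        leaves the base at \<open>i\<close> and agrees with \<open>y\<close> elsewhere, so the
        induction hypothesis applies to its row.\<close>
      have left: "mmul X (adj n U {i}) B y ?z = 0"
        unfolding mmul_def
      proof (rule sum.neutral, rule ballI)
        fix v assume v: "v \<in> X"
        show "adj n U {i} y v * B v ?z = 0"
        proof (cases "(y, v) \<in> srel n U {i}")
          case True
          then have yv: "y j \<noteq> v j \<longleftrightarrow> j = i" if "j \<in> {1..n}" for j
            using that by (simp add: srel_def)
          have "{1..n} - diff_set x v \<subset> {1..n} - diff_set x y"
          proof (rule psubsetI)
            show "{1..n} - diff_set x v \<subseteq> {1..n} - diff_set x y"
            proof
              fix j assume j: "j \<in> {1..n} - diff_set x v"
              then have "x j = v j" by (simp add: mem_diff_set_iff)
              then have "x j = y j" using yv[of j] yi j by (cases "j = i") auto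
              then show "j \<in> {1..n} - diff_set x y" using j by (simp add: mem_diff_set_iff)
            qed
            have "i \<in> diff_set x v"
              using yv[OF i(1)] yi i(1) by (auto simp: mem_diff_set_iff)
            then show "{1..n} - diff_set x v \<noteq> {1..n} - diff_set x y"
              using i by blast
          qed
          then have "card ({1..n} - diff_set x v) < card ({1..n} - diff_set x y)"
            by (intro psubset_card_mono) auto
          then have "B v ?z = 0" using less.hyps v z' by blast
          then show ?thesis by simp
        next
          case False
          then show ?thesis by (simp add: adj_def)
        qed
      qed
      \<comment> \<open>In the other product, a neighbour \<open>v\<close> of \<open>?z\<close>
        along \<open>i\<close> agrees with \<open>z\<close> off \<open>i\<close>; block diagonality
        puts \<open>v i\<close> at the base, which leaves only \<open>v = z\<close>.\<close>
      have "B y v * adj n U {i} v ?z = (if v = z then B y z else 0)" if v: "v \<in> X" for v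
      proof (cases "v = z")
        case True
        have "(z, ?z) \<in> srel n U {i}"
          using less.prems(2) z' t(2) zi by (auto simp: srel_def)
        then show ?thesis using True by (simp add: adj_def)
      next
        case False
        have "B y v = 0" if "(v, ?z) \<in> srel n U {i}"
        proof (rule ccontr)
          assume "B y v \<noteq> 0"
          then have "i \<notin> diff_set x v" using supp less.prems(1) v i(2) by blast
          then have "v i = z i" using i(1) zi by (simp add: mem_diff_set_iff)
          moreover have "v j = z j" if "j \<in> {1..n}" "j \<noteq> i" for j
          proof -
            have "\<forall>a\<in>{1..n}. v a \<noteq> ?z a \<longleftrightarrow> a \<in> {i}"
              using \<open>(v, ?z) \<in> srel n U {i}\<close> by (simp only: srel_def mem_Collect_eq case_prod_conv) blast
            from bspec[OF this that(1)] that(2) show ?thesis by simp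
          qed
          ultimately have "\<forall>j\<in>{1..n}. v j = z j" by blast
          then show False using False points_eq_iff[OF v less.prems(2)] by blast
        qed
        then show ?thesis using False by (auto simp: adj_def)
      qed
      then have "mmul X B (adj n U {i}) y ?z = (\<Sum>v\<in>X. if v = z then B y z else 0)"
        unfolding mmul_def by (intro sum.cong refl)
      also have "\<dots> = B y z"
        using finite_X less.prems(2) by simp
      finally have "mmul X B (adj n U {i}) y ?z = B y z" .
      moreover have "mmul X (adj n U {i}) B = mmul X B (adj n U {i})"
        using i(1) by (intro comm adj_T) simp
      ultimately show False using left nz by simp
    qed
  qed
  show ?thesis
  proof (intro ext)
    fix y z show "B y z = 0 y z"
      using main[of y z] B by (cases "y \<in> X \<and> z \<in> X") (auto simp: mats_def)
  qed
qed

text \<open>The tensor of \<open>cl i - 1\<close> over \<open>S\<close>. At generic entries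
  \<open>cl i\<close> is 1, so these matrices become indicators of the difference set, and
  coefficients can be read off.\<close>

abbreviation cdiff :: "nat set \<Rightarrow> (nat \<Rightarrow> 'u, 'f::field) mat" where
  "cdiff S \<equiv> zmat (\<lambda>i. if i \<in> S then - 1 else 1) (\<lambda>i. of_bool (i \<in> S))"

lemma cdiff_generic:
  assumes "y \<in> X" "z \<in> X" "diff_set x y = {1..n}" "diff_set x z = {1..n}" "S \<subseteq> {1..n}"
  shows "cdiff S y z = (of_bool (S = diff_set y z) :: 'f::field)"
proof -
  have "cl i (y i) (z i) = (1 :: 'f)" if "i \<in> {1..n}" for i
  proof -
    have "i \<in> diff_set x y" "i \<in> diff_set x z"
      using that by (simp_all only: assms)
    then have "x i \<noteq> y i" "x i \<noteq> z i"
      by (simp_all add: mem_diff_set_iff)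
    then show ?thesis by (auto simp: cl_def)
  qed
  then have "cdiff S y z = (\<Prod>i\<in>{1..n}. of_bool (i \<in> S \<longleftrightarrow> y i \<noteq> z i) :: 'f)"
    using assms(1,2) by (auto simp: zmat_def tens_def intro!: prod.cong)
  also have "\<dots> = of_bool (\<forall>i\<in>{1..n}. i \<in> S \<longleftrightarrow> y i \<noteq> z i)"
    by (rule prod_of_bool) simp
  also have "(\<forall>i\<in>{1..n}. i \<in> S \<longleftrightarrow> y i \<noteq> z i) \<longleftrightarrow> S = diff_set y z"
    using assms(5) unfolding set_eq_iff mem_diff_set_iff by blast
  finally show ?thesis .
qed

text \<open>The combination whose coefficients are the generic entries of \<open>A\<close> is
  central and has the same generic entries, so its difference from \<open>A\<close> vanishes by
  \<open>central_eq_0\<close>.\<close>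

lemma central_decomposition:
  fixes A :: "(nat \<Rightarrow> 'u, 'f::field) mat"
  assumes A: "A \<in> T" and comm: "\<And>B. B \<in> T \<Longrightarrow> mmul X B A = mmul X A B"
  shows "\<exists>\<zeta>. A = (\<Sum>S\<in>Pow (circ_part U {1..n}). msmult (\<zeta> S) (cdiff S))"
proof -
  obtain \<zeta> where \<zeta>: "\<And>y z. y \<in> X \<Longrightarrow> z \<in> X \<Longrightarrow> diff_set x y = {1..n} \<Longrightarrow> diff_set x z = {1..n} \<Longrightarrow>
      A y z = \<zeta> (diff_set y z)"
    using T_generic_entries[OF A] by metis
  let ?P = "Pow (circ_part U {1..n})"
  let ?E = "\<Sum>S\<in>?P. msmult (\<zeta> S) (cdiff S)"
  have "A - ?E = 0"
  proof (rule central_eq_0)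
    have "?E \<in> T"
      by (intro mat.subspace_sum[OF subspace_T] mat.subspace_scale[OF subspace_T] zmat_T)
    then show "A - ?E \<in> mats X"
      using A T_mats subspace_mats mat.subspace_diff by blast
    show "mmul X B (A - ?E) = mmul X (A - ?E) B" if "B \<in> T" for B
      unfolding mmul_diff_left mmul_diff_right mmul_sum_left mmul_sum_right
        mmul_smult_left mmul_smult_right comm[OF that] zmat_commute_T[OF that] ..
    show "(A - ?E) y z = 0"
      if yz: "y \<in> X" "z \<in> X" "diff_set x y = {1..n}" "diff_set x z = {1..n}" for y z
    proof -
      \<comment> \<open>Where generic \<open>y\<close> and \<open>z\<close> differ, they and
        \<open>x\<close> occupy three points of \<open>U i\<close>.\<close>
      have "diff_set y z \<subseteq> circ_part U {1..n}"
      proof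
        fix i assume i: "i \<in> diff_set y z"
        then have i': "i \<in> {1..n}" using diff_set_subset by blast
        then have "i \<in> diff_set x y" "i \<in> diff_set x z" by (simp_all only: yz)
        with i have "card {x i, y i, z i} = 3" by (simp add: mem_diff_set_iff)
        moreover have "{x i, y i, z i} \<subseteq> U i"
          using points_mem[OF yz(1) i'] points_mem[OF yz(2) i'] base_mem[OF i'] by blast
        ultimately have "3 \<le> card (U i)" using card_mono[OF fin[OF i'], of "{x i, y i, z i}"] by simp
        then show "i \<in> circ_part U {1..n}" using i' by (simp add: circ_part_def)
      qed
      moreover have "?E y z = (\<Sum>S\<in>?P. if S = diff_set y z then \<zeta> (diff_set y z) else 0)"
        unfolding sum_mat_apply msmult_def
      proof (intro sum.cong refl)
        fix S assume "S \<in> ?P"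
        then have "S \<subseteq> {1..n}" by (auto simp: circ_part_def)
        then show "\<zeta> S * cdiff S y z = (if S = diff_set y z then \<zeta> (diff_set y z) else 0)"
          by (simp only: cdiff_generic[OF yz]) simp
      qed
      moreover have "finite ?P"
        using finite_index[of "circ_part U {1..n}"] by (simp add: circ_part_def)
      ultimately have "?E y z = \<zeta> (diff_set y z)"
        by (simp add: sum.delta)
      then show ?thesis using \<zeta>[OF yz] by simp
    qed
  qed
  then have "A = ?E" by (simp only: right_minus_eq)
  then show ?thesis by (rule exI[of _ \<zeta>])
qed


subsection \<open>Block algebras\<close>

text \<open>For \<open>a\<close> in the plus part this is the product of \<open>Cmat\<close> and
  \<open>blk\<close>, kept as a tensor so that multiplication stays coordinatewise.\<close>

definition blkC :: "nat set \<Rightarrow> nat set \<Rightarrow> (nat \<Rightarrow> 'u, 'f::field) mat" where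
  "blkC s a = zmat (\<lambda>i. if i \<in> a then 0 else blk_al s i) (\<lambda>i. if i \<in> a then 1 else blk_be s i)"

lemma blk_plus:
  assumes "s \<subseteq> minus_part CHAR('f::field) U {1..n}" "i \<in> plus_part CHAR('f) U {1..n}"
  shows "(k i :: 'f) = 0" "i \<notin> s" "blk_al s i = (1 :: 'f)" "blk_be s i = (0 :: 'f)"
proof -
  show k: "(k i :: 'f) = 0" using assms(2) unfolding plus_part_iff by blast
  then have M: "i \<notin> minus_part CHAR('f) U {1..n}" unfolding minus_part_iff by blast
  then show "i \<notin> s" using assms(1) by blast
  with M show "blk_al s i = (1 :: 'f)" "blk_be s i = (0 :: 'f)"
    by (simp_all add: blk_al_def blk_be_def)
qed

lemma blk_local_cases:
  assumes "s \<subseteq> minus_part CHAR('f::field) U {1..n}" "i \<in> {1..n}"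
  obtains (s) "i \<in> s" "(k i :: 'f) \<noteq> 0" "blk_al s i = (1 :: 'f)" "blk_be s i = (- inverse (k i) :: 'f)"
    | (minus) "i \<notin> s" "(k i :: 'f) \<noteq> 0" "blk_al s i = (0 :: 'f)" "blk_be s i = (inverse (k i) :: 'f)"
    | (other) "i \<notin> s" "i \<notin> minus_part CHAR('f) U {1..n}" "blk_al s i = (1 :: 'f)" "blk_be s i = (0 :: 'f)"
proof (cases "i \<in> s")
  case True
  then have "i \<in> minus_part CHAR('f) U {1..n}" using assms(1) by blast
  then have "(k i :: 'f) \<noteq> 0" unfolding minus_part_iff by blast
  with True show ?thesis by (intro s) (simp_all add: blk_al_def blk_be_def)
next
  case False
  show ?thesis
  proof (cases "i \<in> minus_part CHAR('f) U {1..n}")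
    case True
    then have "(k i :: 'f) \<noteq> 0" unfolding minus_part_iff by blast
    with False True show ?thesis by (intro minus) (simp_all add: blk_al_def blk_be_def)
  next
    case M: False
    with False show ?thesis by (intro other) (simp_all add: blk_al_def blk_be_def)
  qed
qed

lemma blk_local_idem:
  assumes "s \<subseteq> minus_part CHAR('f::field) U {1..n}" "i \<in> {1..n}"
  shows "blk_al s i * blk_al s i = (blk_al s i :: 'f)"
    and "blk_al s i * blk_be s i + blk_be s i * blk_al s i + k i * blk_be s i * blk_be s i = (blk_be s i :: 'f)"
  by (rule blk_local_cases[OF assms]; simp only:; simp del: of_nat_diff)+

lemma blkC_mats: "blkC s a \<in> mats X"
  unfolding blkC_def by (rule zmat_mats)

lemma blk_idem:
  assumes "s \<subseteq> minus_part CHAR('f::field) U {1..n}"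
  shows "mmul X (blk s) (blk s) = (blk s :: (nat \<Rightarrow> 'u, 'f) mat)"
  unfolding zmat_mult using blk_local_idem[OF assms] by (intro zmat_cong)

lemma Cmat_blk:
  assumes "s \<subseteq> minus_part CHAR('f::field) U {1..n}" "a \<subseteq> plus_part CHAR('f) U {1..n}"
  shows "mmul X (Cmat n U x a) (blk s) = (blkC s a :: (nat \<Rightarrow> 'u, 'f) mat)"
proof -
  have a: "a \<subseteq> {1..n}" using assms(2) unfolding plus_part_def by blast
  show ?thesis
    unfolding Cmat_eq_zmat[OF a] zmat_mult blkC_def
  proof (rule zmat_cong)
    fix i assume "i \<in> {1..n}"
    show "of_bool (i \<notin> a) * blk_al s i = (if i \<in> a then 0 else blk_al s i :: 'f)" by simp
    show "of_bool (i \<notin> a) * blk_be s i + of_bool (i \<in> a) * blk_al s i + k i * of_bool (i \<in> a) * blk_be s i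
        = (if i \<in> a then 1 else blk_be s i :: 'f)"
    proof (cases "i \<in> a")
      case True
      then show ?thesis using blk_plus[OF assms(1), of i] assms(2) by auto
    qed simp
  qed
qed

text \<open>At a common plus coordinate the square of \<open>cl i\<close> is
  \<open>k i * cl i = 0\<close>, and one zero factor kills the tensor. For disjoint sets each
  coordinate multiplies \<open>cl i\<close> by the identity or an idempotent by itself.\<close>

lemma blkC_mult:
  assumes s: "s \<subseteq> minus_part CHAR('f::field) U {1..n}"
    and a: "a \<subseteq> plus_part CHAR('f) U {1..n}" and b: "b \<subseteq> plus_part CHAR('f) U {1..n}"
  shows "mmul X (blkC s a) (blkC s b) = (if a \<inter> b = {} then blkC s (a \<union> b) else 0 :: (nat \<Rightarrow> 'u, 'f) mat)"
proof (cases "a \<inter> b = {}")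
  case True
  have "mmul X (blkC s a) (blkC s b) = (blkC s (a \<union> b) :: (nat \<Rightarrow> 'u, 'f) mat)"
    unfolding blkC_def zmat_mult
  proof (rule zmat_cong)
    fix i assume i: "i \<in> {1..n}"
    have plus: "blk_al s i = (1 :: 'f)" "blk_be s i = (0 :: 'f)" if "i \<in> a \<union> b"
      using that a b blk_plus[OF s, of i] by blast+
    show "(if i \<in> a then 0 else blk_al s i) * (if i \<in> b then 0 else blk_al s i)
        = (if i \<in> a \<union> b then 0 else blk_al s i :: 'f)"
      using blk_local_idem(1)[OF s i] by simp
    consider "i \<in> a" "i \<notin> b" | "i \<in> b" "i \<notin> a" | "i \<notin> a \<union> b" using True by blast
    then show "(if i \<in> a then 0 else blk_al s i) * (if i \<in> b then 1 else blk_be s i) +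
        (if i \<in> a then 1 else blk_be s i) * (if i \<in> b then 0 else blk_al s i) +
        k i * (if i \<in> a then 1 else blk_be s i) * (if i \<in> b then 1 else blk_be s i)
        = (if i \<in> a \<union> b then 1 else blk_be s i :: 'f)"
    proof cases
      case 3
      then show ?thesis using blk_local_idem(2)[OF s i] by simp
    qed (use plus in simp_all)
  qed
  then show ?thesis using True by simp
next
  case False
  then obtain i where i: "i \<in> a" "i \<in> b" by blast
  then have "(k i :: 'f) = 0" "i \<in> {1..n}"
    using a blk_plus(1)[OF s, of i] unfolding plus_part_def by blast+
  then have "mmul X (blkC s a) (blkC s b) = (0 :: (nat \<Rightarrow> 'u, 'f) mat)"
    unfolding blkC_def zmat_mult using i by (intro zmat_eq_0[of i]) simp_all
  then show ?thesis using False by simp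
qed

lemma blkC_top_nonzero:
  assumes s: "s \<subseteq> minus_part CHAR('f::field) U {1..n}"
  shows "blkC s (plus_part CHAR('f) U {1..n}) \<noteq> (0 :: (nat \<Rightarrow> 'u, 'f) mat)"
proof -
  \<comment> \<open>Points off the base give \<open>cl i\<close> the entry 1. With
    \<open>p \<noteq> q\<close> exactly on \<open>s\<close>, the local entries are 1,
    \<open>inverse (k i)\<close> or \<open>- inverse (k i)\<close>. On \<open>s\<close>, the choice
    \<open>p = q\<close> would give \<open>1 - inverse (k i)\<close>, which may vanish; there
    \<open>U i\<close> does not have size 2, so a second point exists.\<close>
  have "\<exists>p\<in>U i - {x i}. \<exists>q\<in>U i - {x i}. p = q \<longleftrightarrow> i \<notin> s" if i: "i \<in> {1..n}" for i
  proof -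
    have c: "card (U i - {x i}) = card (U i) - 1"
      using base_mem[OF i] by simp
    then have "card (U i - {x i}) \<noteq> 0" using card[OF i] by simp
    then have "U i - {x i} \<noteq> {}" by (metis card.empty)
    then obtain p where p: "p \<in> U i - {x i}" by blast
    show ?thesis
    proof (cases "i \<in> s")
      case True
      then have "card (U i) \<noteq> 2" using s unfolding minus_part_def by blast
      then have "card (U i - {x i} - {p}) \<noteq> 0"
        using c p card[OF i] by simp
      then have "U i - {x i} - {p} \<noteq> {}" by (metis card.empty)
      then obtain q where "q \<in> U i - {x i} - {p}" by blast
      with p True show ?thesis by blast
    qed (use p in blast)
  qed
  then have "\<forall>i\<in>{1..n}. \<exists>p. p \<in> U i - {x i} \<and> (\<exists>q\<in>U i - {x i}. p = q \<longleftrightarrow> i \<notin> s)" by blast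
  from bchoice[OF this] obtain p
    where p: "\<forall>i\<in>{1..n}. p i \<in> U i - {x i} \<and> (\<exists>q\<in>U i - {x i}. p i = q \<longleftrightarrow> i \<notin> s)" ..
  then have "\<forall>i\<in>{1..n}. \<exists>q. q \<in> U i - {x i} \<and> (p i = q \<longleftrightarrow> i \<notin> s)" by blast
  from bchoice[OF this] obtain q
    where q: "\<forall>i\<in>{1..n}. q i \<in> U i - {x i} \<and> (p i = q i \<longleftrightarrow> i \<notin> s)" ..
  let ?P = "plus_part CHAR('f) U {1..n}"
  let ?p = "restrict p {1..n}" and ?q = "restrict q {1..n}"
  have X: "?p \<in> X" "?q \<in> X"
    using p q unfolding points_def restrict_PiE_iff by blast+
  have "(if i \<in> ?P then 0 else blk_al s i) * of_bool (p i = q i) + (if i \<in> ?P then 1 else blk_be s i) * cl i (p i) (q i) \<noteq> (0 :: 'f)"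
    if i: "i \<in> {1..n}" for i
  proof -
    have cl: "cl i (p i) (q i) = (1 :: 'f)"
      using bspec[OF p i] bspec[OF q i] by (simp add: cl_def)
    have eq: "p i = q i \<longleftrightarrow> i \<notin> s" using bspec[OF q i] by blast
    show ?thesis
    proof (cases "i \<in> ?P")
      case True
      then show ?thesis using cl by simp
    next
      case False
      show ?thesis
        using s i by (rule blk_local_cases) (simp_all add: False cl eq del: of_nat_diff)
    qed
  qed
  then have "(\<Prod>i\<in>{1..n}. (if i \<in> ?P then 0 else blk_al s i) * of_bool (p i = q i) +
      (if i \<in> ?P then 1 else blk_be s i) * cl i (p i) (q i)) \<noteq> (0 :: 'f)"
    by (subst prod_zero_iff) (simp_all only: finite_atLeastAtMost, blast)
  moreover have "blkC s ?P ?p ?q = (\<Prod>i\<in>{1..n}. (if i \<in> ?P then 0 else blk_al s i) * of_bool (p i = q i) +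
      (if i \<in> ?P then 1 else blk_be s i) * cl i (p i) (q i) :: 'f)"
    unfolding blkC_def zmat_def tens_def using X by (simp only: if_True simp_thms) (intro prod.cong; simp)
  ultimately have "blkC s ?P ?p ?q \<noteq> (0 :: 'f)" by simp
  then show ?thesis by (metis zero_fun_apply)
qed

lemma squarefree_monomials_blkC:
  assumes s: "s \<subseteq> minus_part CHAR('f::field) U {1..n}"
  shows "squarefree_monomials X (plus_part CHAR('f) U {1..n}) (blkC s :: _ \<Rightarrow> (nat \<Rightarrow> 'u, 'f) mat)"
proof
  show "finite (plus_part CHAR('f) U {1..n})"
    by (rule finite_index) (auto simp: plus_part_def)
qed (use finite_X blkC_mats blkC_mult[OF s] blkC_top_nonzero[OF s] in auto)

text \<open>At a minus coordinate \<open>cl i - 1\<close> acts on the block by a scalar,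
  \<open>-1\<close> on \<open>1 - cl / k\<close> and \<open>k - 1\<close> on \<open>cl / k\<close>;
  these are the values of \<gamma>. Only the plus coordinates are left to be multiplied out.\<close>

lemma cdiff_blk:
  assumes s: "s \<subseteq> minus_part CHAR('f::field) U {1..n}" and S: "S \<subseteq> circ_part U {1..n}"
  shows "mmul X (cdiff S) (blk s) \<in> mat.span (blkC s ` Pow (plus_part CHAR('f) U {1..n}) :: (nat \<Rightarrow> 'u, 'f) mat set)"
proof -
  let ?P = "plus_part CHAR('f) U {1..n}"
  define \<gamma> :: "nat \<Rightarrow> 'f" where "\<gamma> i = (if i \<in> S - ?P then if i \<in> s then - 1 else k i - 1 else 1)" for i
  define \<alpha> :: "nat \<Rightarrow> 'f" where "\<alpha> i = (if i \<in> S \<inter> ?P then - 1 else blk_al s i)" for i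
  define \<beta> :: "nat \<Rightarrow> 'f" where "\<beta> i = (if i \<in> S \<inter> ?P then 1 else blk_be s i)" for i
  have "mmul X (cdiff S) (blk s) = zmat (\<lambda>i. \<gamma> i * \<alpha> i) (\<lambda>i. \<gamma> i * \<beta> i)"
    unfolding zmat_mult
  proof (rule zmat_cong)
    fix i assume i: "i \<in> {1..n}"
    let ?a = "if i \<in> S then - 1 else 1 :: 'f" and ?b = "of_bool (i \<in> S) :: 'f"
    have "?a * blk_al s i = \<gamma> i * \<alpha> i \<and> ?a * blk_be s i + ?b * blk_al s i + k i * ?b * blk_be s i = \<gamma> i * \<beta> i"
    proof (cases "i \<in> S")
      case True
      show ?thesis
      proof (cases "i \<in> ?P")
        case P: True
        show ?thesis
          using True P blk_plus[OF s P] by (simp add: \<alpha>_def \<beta>_def \<gamma>_def)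
      next
        case False
        have "card (U i) \<noteq> 2" using True S by (auto simp: circ_part_def)
        then have M: "i \<in> minus_part CHAR('f) U {1..n}"
          using False i unfolding plus_part_iff minus_part_iff by blast
        show ?thesis
          using s i
        proof (cases rule: blk_local_cases)
          case s
          then show ?thesis using True False
            by (simp add: \<alpha>_def \<beta>_def \<gamma>_def field_simps del: of_nat_diff)
        next
          case minus
          then show ?thesis using True False
            by (simp add: \<alpha>_def \<beta>_def \<gamma>_def field_simps del: of_nat_diff)
        next
          case other
          then show ?thesis using M by blast
        qed
      qed
    next
      case False
      then show ?thesis by (simp add: \<alpha>_def \<beta>_def \<gamma>_def)
    qed
    then show "?a * blk_al s i = \<gamma> i * \<alpha> i"
      and "?a * blk_be s i + ?b * blk_al s i + k i * ?b * blk_be s i = \<gamma> i * \<beta> i"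
      by blast+
  qed
  also have "\<dots> = msmult (\<Prod>i\<in>{1..n}. \<gamma> i) (zmat \<alpha> \<beta>)"
    by (rule zmat_scale)
  finally have eq: "mmul X (cdiff S) (blk s) = msmult (\<Prod>i\<in>{1..n}. \<gamma> i) (zmat \<alpha> \<beta>)" .
  have P: "?P \<subseteq> {1..n}" unfolding plus_part_def by blast
  have "zmat (\<lambda>i. if i \<in> ?P then of_bool (i \<notin> a) else \<alpha> i) (\<lambda>i. if i \<in> ?P then of_bool (i \<in> a) else \<beta> i) = blkC s a"
    if "a \<in> Pow ?P" for a
    unfolding blkC_def using that blk_plus[OF s] by (intro zmat_cong) (auto simp: \<alpha>_def \<beta>_def)
  then have "zmat \<alpha> \<beta> = (\<Sum>a\<in>Pow ?P. msmult ((\<Prod>i\<in>a. \<beta> i) * (\<Prod>i\<in>?P - a. \<alpha> i)) (blkC s a))"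
    unfolding zmat_expand[OF P, of \<alpha> \<beta>] by (intro sum.cong refl) simp
  then have "zmat \<alpha> \<beta> \<in> mat.span (blkC s ` Pow ?P)"
    by (simp only:) (intro mat.span_sum mat.span_scale mat.span_base imageI)
  then show ?thesis
    unfolding eq by (rule mat.span_scale)
qed

text \<open>An element that commutes with the block algebra and lies in it commutes with all of \<open>T\<close>,
  because the block idempotent is central.\<close>

lemma alg_center_block:
  assumes s: "s \<subseteq> minus_part CHAR('f::field) U {1..n}"
  shows "alg_center X ((\<lambda>A. mmul X A (blk s)) ` T) =
    mat.span (blkC s ` Pow (plus_part CHAR('f) U {1..n}) :: (nat \<Rightarrow> 'u, 'f) mat set)"
    (is "alg_center X ?B = mat.span ?C")
proof
  have DT: "blk s \<in> (T :: (nat \<Rightarrow> 'u, 'f) mat set)" by (rule zmat_T)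
  \<comment> \<open>As \<open>blk s\<close> is idempotent, the block algebra consists of the
    elements of \<open>T\<close> fixed by right multiplication with it.\<close>
  have B_iff: "A \<in> ?B \<longleftrightarrow> A \<in> T \<and> mmul X A (blk s) = A" for A
  proof
    assume "A \<in> ?B"
    then obtain A' where "A' \<in> T" "A = mmul X A' (blk s)" by blast
    then show "A \<in> T \<and> mmul X A (blk s) = A"
      using mmul_T[OF _ DT] by (simp add: mmul_assoc blk_idem[OF s])
  next
    assume "A \<in> T \<and> mmul X A (blk s) = A"
    then show "A \<in> ?B" by (metis imageI)
  qed
  show "mat.span ?C \<subseteq> alg_center X ?B"
  proof (rule mat.span_minimal)
    show "?C \<subseteq> alg_center X ?B"
    proof
      fix A assume "A \<in> ?C"
      then obtain a where a: "a \<subseteq> plus_part CHAR('f) U {1..n}" and A: "A = blkC s a" by blast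
      have "A \<in> ?B"
        unfolding A Cmat_blk[OF s a, symmetric] using Cmat_T by blast
      moreover have "mmul X A b = mmul X b A" if "b \<in> ?B" for b
      proof -
        have "b \<in> T" using that unfolding B_iff by blast
        then show ?thesis unfolding A blkC_def by (rule zmat_commute_T[symmetric])
      qed
      ultimately show "A \<in> alg_center X ?B" by (simp add: alg_center_def)
    qed
    have "A + A' \<in> ?B" if "A \<in> ?B" "A' \<in> ?B" for A A'
      using that unfolding B_iff by (simp add: mmul_add_left mat.subspace_add[OF subspace_T])
    moreover have "msmult c A \<in> ?B" if "A \<in> ?B" for A c
      using that unfolding B_iff by (simp add: mmul_smult_left mat.subspace_scale[OF subspace_T])
    moreover have "0 \<in> ?B"
      unfolding B_iff by (simp add: mat.subspace_0[OF subspace_T])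
    ultimately show "mat.subspace (alg_center X ?B)"
      unfolding mat.subspace_def alg_center_def
      by (simp add: mmul_add_left mmul_add_right mmul_smult_left mmul_smult_right)
  qed
  show "alg_center X ?B \<subseteq> mat.span ?C"
  proof
    fix A assume A: "A \<in> alg_center X ?B"
    then have AB: "A \<in> ?B" and comm: "\<And>b. b \<in> ?B \<Longrightarrow> mmul X A b = mmul X b A"
      unfolding alg_center_def by blast+
    then have AT: "A \<in> T" and AD: "mmul X A (blk s) = A" unfolding B_iff by blast+
    have DA: "mmul X (blk s) A = A" using zmat_commute_T[OF AT] AD by metis
    have "mmul X B A = mmul X A B" if B: "B \<in> T" for B
    proof -
      have "mmul X B A = mmul X (mmul X B (blk s)) A"
        by (simp add: mmul_assoc DA)
      also have "\<dots> = mmul X A (mmul X B (blk s))"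
        by (rule comm[OF imageI[OF B], symmetric])
      also have "\<dots> = mmul X (mmul X A (blk s)) B"
        by (simp add: mmul_assoc zmat_commute_T[OF B])
      finally show ?thesis by (simp add: AD)
    qed
    from central_decomposition[OF AT this] obtain \<zeta>
      where "A = (\<Sum>S\<in>Pow (circ_part U {1..n}). msmult (\<zeta> S) (cdiff S))" by blast
    \<comment> \<open>Right multiplication by \<open>blk s\<close> fixes \<open>A\<close> and moves
      each summand into the block.\<close>
    then have "A = (\<Sum>S\<in>Pow (circ_part U {1..n}). msmult (\<zeta> S) (mmul X (cdiff S) (blk s)))"
      using AD by (simp add: mmul_sum_left mmul_smult_left)
    also have "\<dots> \<in> mat.span ?C"
      using cdiff_blk[OF s] by (intro mat.span_sum mat.span_scale) blast
    finally show "A \<in> mat.span ?C" .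
  qed
qed

end

theorem theorem5p9:
  fixes n :: nat and U :: "nat \<Rightarrow> 'u set" and x :: "nat \<Rightarrow> 'u"
    and Cl :: "nat \<Rightarrow> (nat set \<times> nat set \<times> nat set) set"
    and g :: nat and h :: "nat set"
  assumes "1 \<le> n"
    and "\<forall>a\<in>{1..n}. finite (U a) \<and> 2 \<le> card (U a)"
    and "x \<in> points n U"
    and "bij_betw Cl {1..2 ^ card (minus_part CHAR('f::field) U {1..n})} (dclasses CHAR('f) n U)"
    and "g \<in> {1..2 ^ card (minus_part CHAR('f) U {1..n})}"
    and "h \<subseteq> plus_part CHAR('f) U {1..n}"
  shows "({1..n}, h, {1..n}) \<in> ptriples n U \<and>
    (let X = points n U;
         np = card (plus_part CHAR('f) U {1..n});
         Dg = (block_idem n U x (Cl g) :: (nat \<Rightarrow> 'u, 'f) mat);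
         Z = alg_center X (block_alg n U x (Cl g) :: (nat \<Rightarrow> 'u, 'f) mat set);
         R = jacobson_radical X Z
     in is_basis {mmul X (Cmat n U x a) Dg | a. a \<subseteq> plus_part CHAR('f) U {1..n}} Z
      \<and> mat.dim Z = 2 ^ np
      \<and> is_basis {mmul X (Cmat n U x a) Dg | a. a \<noteq> {} \<and> a \<subseteq> plus_part CHAR('f) U {1..n}} R
      \<and> has_nilpotent_index X R (np + 1)
      \<and> mat.dim R = 2 ^ np - 1)"
proof -
  interpret factorial_scheme n U x
    using assms(2,3) by unfold_locales auto
  let ?P = "plus_part CHAR('f) U {1..n}" and ?M = "minus_part CHAR('f) U {1..n}"
  have finP: "finite ?P"
    by (rule finite_index) (auto simp: plus_part_def)
  have "Cl g \<in> dclasses CHAR('f) n U"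
    using bij_betwE[OF assms(4)] assms(5) by blast
  then obtain t where t: "t \<in> dtriples CHAR('f) n U" and Cl_t: "Cl g = drel CHAR('f) n U `` {t}"
    unfolding dclasses_def by (rule quotientE)
  define s where "s = (case t of (a, b, c) \<Rightarrow> minus_part CHAR('f) U a - b)"
  \<comment> \<open>A class is a fibre of the invariant, so the enumeration enters only through the
    value \<open>s\<close>.\<close>
  have Cl: "Cl g = {t \<in> dtriples CHAR('f) n U. (case t of (a, b, c) \<Rightarrow> minus_part CHAR('f) U a - b) = s}"
    unfolding Cl_t s_def using t by (auto simp: drel_def)
  have s: "s \<subseteq> ?M"
    using t unfolding s_def by (auto simp: dtriples_def ptriples_def minus_part_def)
  have D: "block_idem n U x (Cl g) = (blk s :: (nat \<Rightarrow> 'u, 'f) mat)"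
    unfolding Cl by (rule block_idem_eq_blk[OF s])
  interpret squarefree_monomials X ?P "blkC s :: _ \<Rightarrow> (nat \<Rightarrow> 'u, 'f) mat"
    by (rule squarefree_monomials_blkC[OF s])
  have center: "alg_center X (block_alg n U x (Cl g) :: (nat \<Rightarrow> 'u, 'f) mat set) = mat.span (blkC s ` Pow ?P)"
    unfolding block_alg_def D by (rule alg_center_block[OF s])
  have set: "{mmul X (Cmat n U x a) (blk s) | a. a \<subseteq> ?P} = (blkC s ` Pow ?P :: (nat \<Rightarrow> 'u, 'f) mat set)"
    using Cmat_blk[OF s] by (auto simp: image_iff) metis+
  have set': "{mmul X (Cmat n U x a) (blk s) | a. a \<noteq> {} \<and> a \<subseteq> ?P} = (blkC s ` (Pow ?P - {{}}) :: (nat \<Rightarrow> 'u, 'f) mat set)"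
  proof (intro equalityI subsetI)
    fix A :: "(nat \<Rightarrow> 'u, 'f) mat"
    assume "A \<in> {mmul X (Cmat n U x a) (blk s) | a. a \<noteq> {} \<and> a \<subseteq> ?P}"
    then obtain a where "A = mmul X (Cmat n U x a) (blk s)" "a \<noteq> {}" "a \<subseteq> ?P" by blast
    then show "A \<in> blkC s ` (Pow ?P - {{}})" by (simp add: Cmat_blk[OF s])
  next
    fix A :: "(nat \<Rightarrow> 'u, 'f) mat"
    assume "A \<in> blkC s ` (Pow ?P - {{}})"
    then obtain a where a: "A = blkC s a" "a \<noteq> {}" "a \<subseteq> ?P" by blast
    then have "A = mmul X (Cmat n U x a) (blk s)" by (simp add: Cmat_blk[OF s])
    with a show "A \<in> {mmul X (Cmat n U x a) (blk s) | a. a \<noteq> {} \<and> a \<subseteq> ?P}" by blast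
  qed
  have rad: "jacobson_radical X (mat.span (blkC s ` Pow ?P)) = (mat.span (blkC s ` (Pow ?P - {{}})) :: (nat \<Rightarrow> 'u, 'f) mat set)"
    using jacobson_radical_Z level_1 by simp
  have nil: "has_nilpotent_index X (mat.span (blkC s ` (Pow ?P - {{}})) :: (nat \<Rightarrow> 'u, 'f) mat set) (card ?P + 1)"
    using has_nilpotent_index_level_1 unfolding level_1 .
  have dims: "mat.dim (mat.span (blkC s ` Pow ?P) :: (nat \<Rightarrow> 'u, 'f) mat set) = 2 ^ card ?P"
    "mat.dim (mat.span (blkC s ` (Pow ?P - {{}})) :: (nat \<Rightarrow> 'u, 'f) mat set) = 2 ^ card ?P - 1"
    using dim_c[of "Pow ?P"] dim_c[of "Pow ?P - {{}}"] finP by (simp_all add: card_Pow)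
  have "h \<subseteq> circ_part U {1..n}"
  proof
    fix i assume "i \<in> h"
    then have "i \<in> {1..n}" "(k i :: 'f) = 0"
      using assms(6) plus_part_iff[of i, where 'f = 'f] by blast+
    \<comment> \<open>Two points would make \<open>k i = 1\<close>, which is nonzero in a
      field.\<close>
    moreover from this(2) have "card (U i) \<noteq> 2" by auto
    ultimately show "i \<in> circ_part U {1..n}" by (simp add: circ_part_def)
  qed
  then have "({1..n}, h, {1..n}) \<in> ptriples n U"
    by (auto simp: ptriples_def circ_part_def)
  then show ?thesis
    unfolding Let_def center D set set' rad
    using is_basis_c[of "Pow ?P"] is_basis_c[of "Pow ?P - {{}}"] dims nil by simp
qed

end
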